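(* Let $m>1$. All finite inner resolutions of a pure co-spherically contractive Hilbert module $\mathcal{M}$ over $\mathbb{C}[z_1,\dots,z_m]$ are trivial inner resolutions.
   Context: A Hilbert module over $\mathbb{C}[z_1,\dots,z_m]$ is a Hilbert space $\mathcal{M}$ with a commuting $m$-tuple of bounded operators $M_1,\dots,M_m$ giving multiplication by $z_1,\dots,z_m$. It is co-spherically contractive if $\sum_i M_iM_i^*\le I$; then with $P(A)=\sum_i M_iAM_i^*$ the sequence $P^l(I)$ decreases, and $\mathcal{M}$ is pure if $P^l(I)\to0$ in the strong operator topology as $l\to\infty$. A module map is a bounded operator commuting with the module actions. The Drury-Arveson (DA) module $H^2_m$ is the reproducing kernel Hilbert space on the open unit ball $\mathbb{B}^m\subset\mathbb{C}^m$ with kernel $(1-\sum_{i=1}^m z_i\bar w_i)^{-1}$. For a Hilbert space $\mathcal{E}$, $H^2_m\otimes\mathcal{E}$ is identified with the Hilbert space of $\mathcal{E}$-valued holomorphic functions $f(z)=\sum_{\bm{k}\in\mathbb{N}^m}a_{\bm{k}}z^{\bm{k}}$ on $\mathbb{B}^m$ with $\|f\|^2=\sum_{\bm{k}}\|a_{\bm{k}}\|^2\frac{k_1!\cdots k_m!}{(k_1+\cdots+k_m)!}<\infty$ (here $\mathbb{N}$ includes $0$), a Hilbert module with $z_i$ acting by multiplication by the coordinate function. A multiplier $\varphi\in\mathcal{M}(\mathcal{E},\mathcal{E}_* )$ is a holomorphic function $\varphi:\mathbb{B}^m\to\mathcal{L}(\mathcal{E},\mathcal{E}_* )$ with $\varphi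 f\in H^2_m\otimes\mathcal{E}_*$ for all $f\in H^2_m\otimes\mathcal{E}$; $M_\varphi f=\varphi f$ is the associated bounded module map. The multiplier $\varphi$ is inner if $M_\varphi$ is a partial isometry. A finite inner resolution (of length $N<\infty$) of $\mathcal{M}$ consists of Hilbert spaces $\mathcal{E}_0,\dots,\mathcal{E}_N$, inner multipliers $\varphi_k\in\mathcal{M}(\mathcal{E}_k,\mathcal{E}_{k-1})$ with $X_k=M_{\varphi_k}$ for $k=1,\dots,N$, and a co-isometric module map $X_0:H^2_m\otimes\mathcal{E}_0\to\mathcal{M}$, such that $$0\to H^2_m\otimes\mathcal{E}_N\xrightarrow{X_N}H^2_m\otimes\mathcal{E}_{N-1}\to\cdots\to H^2_m\otimes\mathcal{E}_1\xrightarrow{X_1}H^2_m\otimes\mathcal{E}_0\xrightarrow{X_0}\mathcal{M}\to0$$ is exact. Trivial extension: given such a resolution, ending on the left in $0\to H^2_m\otimes\mathcal{E}_N\xrightarrow{X_N}\cdots$, and a nontrivial Hilbert space $\mathcal{E}_{N+1}$, its trivial extension by $\mathcal{E}_{N+1}$ is the longer resolution $$0\to H^2_m\otimes\mathcal{E}_{N+1}\xrightarrow{X_{N+1}}H^2_m\otimes(\mathcal{E}_{N+1}\oplus\mathcal{E}_N)\xrightarrow{\tilde X_N}\cdots\to\mathcal{M}\to0,$$ where $X_{N+1}$ is the inclusion map, $\tilde X_N$ is the linear map equal to $X_N$ on $H^2_m\otimes\mathcal{E}_N$ and to $0$ on $H^2_m\otimes\mathcal{E}_{N+1}$, and all the other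 spaces and maps are unchanged. A trivial inner resolution is a resolution equivalent to one obtained by a series of such trivial extensions starting from the resolution $0\to H^2_m\otimes\mathcal{E}\xrightarrow{X}H^2_m\otimes\mathcal{E}\to0$ with $X=I_{H^2_m\otimes\mathcal{E}}$, for some Hilbert space $\mathcal{E}$ (here $X$ plays the role of $X_0$). Two resolutions are equivalent if there are unitary module maps between the corresponding modules of the two sequences (including the resolved modules) intertwining the corresponding connecting maps.
   Formalization: Resolutions differing by zero modules on the left are identified, and zero modules may be inserted on the left before a trivial extension; otherwise 0→H(E)→H(E)→H(E0)→H(E0)→0 with maps I, 0, I (E, E0 nonzero) would be a counterexample. *)

theory Defs
  imports "HOL-Analysis.Analysis"
begin

section \<open>Complex Hilbert spaces\<close>

text \<open>
  The inner product is linear in the first argument. The real Hilbert space structure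
  inherited from the class real_inner is the underlying real one.
\<close>

class complex_hilbert = real_inner + banach +
  fixes scaleC :: "complex \<Rightarrow> 'a \<Rightarrow> 'a"  (infixr "*\<^sub>C" 75)
    and cinner :: "'a \<Rightarrow> 'a \<Rightarrow> complex"
  assumes scaleC_add_right: "c *\<^sub>C (x + y) = c *\<^sub>C x + c *\<^sub>C y"
    and scaleC_add_left: "(c + d) *\<^sub>C x = c *\<^sub>C x + d *\<^sub>C x"
    and scaleC_scaleC: "c *\<^sub>C (d *\<^sub>C x) = (c * d) *\<^sub>C x"
    and scaleC_of_real: "complex_of_real r *\<^sub>C x = r *\<^sub>R x"
    and cinner_add_left: "cinner (x + y) z = cinner x z + cinner y z"
    and cinner_scaleC_left: "cinner (c *\<^sub>C x) y = c * cinner x y"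
    and cinner_commute: "cinner x y = cnj (cinner y x)"
    and Re_cinner: "Re (cinner x y) = inner x y"

instantiation complex :: complex_hilbert
begin

definition scaleC_complex :: "complex \<Rightarrow> complex \<Rightarrow> complex"
  where "scaleC_complex c x = c * x"

definition cinner_complex :: "complex \<Rightarrow> complex \<Rightarrow> complex"
  where "cinner_complex x y = x * cnj y"

instance
  by standard
    (auto simp: scaleC_complex_def cinner_complex_def inner_complex_def algebra_simps
      scaleR_conv_of_real)

end

definition clinear :: "('a::complex_hilbert \<Rightarrow> 'b::complex_hilbert) \<Rightarrow> bool"
  where "clinear A \<longleftrightarrow> (\<forall>x y. A (x + y) = A x + A y) \<and> (\<forall>c x. A (c *\<^sub>C x) = c *\<^sub>C A x)"

definition bounded_clinear :: "('a::complex_hilbert \<Rightarrow> 'b::complex_hilbert) \<Rightarrow> bool"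
  where "bounded_clinear A \<longleftrightarrow> clinear A \<and> bounded_linear A"

text \<open>Unique, and bounded complex linear, when \<open>A\<close> is bounded complex linear.\<close>

definition cadjoint :: "('a::complex_hilbert \<Rightarrow> 'b::complex_hilbert) \<Rightarrow> 'b \<Rightarrow> 'a"
  where "cadjoint A = (SOME B. \<forall>x y. cinner (A x) y = cinner x (B y))"

text \<open>
  Any finite family of Hilbert spaces embeds isometrically in a common one. The coefficient
  spaces occurring together in a resolution are therefore taken to be closed subspaces of an
  arbitrary ambient Hilbert space.
\<close>

definition hilbert_subspace :: "'a::complex_hilbert set \<Rightarrow> bool"
  where "hilbert_subspace E \<longleftrightarrow> 0 \<in> E \<and> (\<forall>x\<in>E. \<forall>y\<in>E. x + y \<in> E) \<and>
    (\<forall>c. \<forall>x\<in>E. c *\<^sub>C x \<in> E) \<and> closed E"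

text \<open>
  \<open>S\<close>, with the inclusions \<open>i\<close> and \<open>j\<close>, is the Hilbert space direct sum of \<open>F\<close> and \<open>E\<close>.
\<close>

definition direct_sum ::
  "'a::complex_hilbert set \<Rightarrow> 'a set \<Rightarrow> 'a set \<Rightarrow> ('a \<Rightarrow> 'a) \<Rightarrow> ('a \<Rightarrow> 'a) \<Rightarrow> bool"
  where "direct_sum F E S i j \<longleftrightarrow>
    hilbert_subspace F \<and> hilbert_subspace E \<and> hilbert_subspace S \<and>
    (\<forall>x\<in>F. \<forall>y\<in>F. i (x + y) = i x + i y) \<and> (\<forall>c. \<forall>x\<in>F. i (c *\<^sub>C x) = c *\<^sub>C i x) \<and>
    (\<forall>x\<in>E. \<forall>y\<in>E. j (x + y) = j x + j y) \<and> (\<forall>c. \<forall>x\<in>E. j (c *\<^sub>C x) = c *\<^sub>C j x) \<and>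
    (\<forall>x\<in>F. \<forall>y\<in>F. cinner (i x) (i y) = cinner x y) \<and>
    (\<forall>x\<in>E. \<forall>y\<in>E. cinner (j x) (j y) = cinner x y) \<and>
    (\<forall>x\<in>F. \<forall>y\<in>E. cinner (i x) (j y) = 0) \<and>
    S = {i x + j y | x y. x \<in> F \<and> y \<in> E}"


section \<open>Hilbert modules\<close>

text \<open>
  A finite index type \<open>'m\<close> plays the role of \<open>{1,\<dots>,m}\<close>, with \<open>m = CARD('m)\<close>; \<open>T i\<close> is
  multiplication by the \<open>i\<close>-th coordinate.
\<close>

definition hilbert_module :: "('m::finite \<Rightarrow> 'h::complex_hilbert \<Rightarrow> 'h) \<Rightarrow> bool"
  where "hilbert_module T \<longleftrightarrow>
    (\<forall>i. bounded_clinear (T i)) \<and> (\<forall>i j x. T i (T j x) = T j (T i x))"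

definition P_map ::
  "('m::finite \<Rightarrow> 'h::complex_hilbert \<Rightarrow> 'h) \<Rightarrow> ('h \<Rightarrow> 'h) \<Rightarrow> 'h \<Rightarrow> 'h"
  where "P_map T A = (\<lambda>x. \<Sum>i\<in>UNIV. T i (A (cadjoint (T i) x)))"

definition cospherically_contractive :: "('m::finite \<Rightarrow> 'h::complex_hilbert \<Rightarrow> 'h) \<Rightarrow> bool"
  where "cospherically_contractive T \<longleftrightarrow>
    (\<forall>x. Re (cinner (\<Sum>i\<in>UNIV. T i (cadjoint (T i) x)) x) \<le> Re (cinner x x))"

definition pure_module :: "('m::finite \<Rightarrow> 'h::complex_hilbert \<Rightarrow> 'h) \<Rightarrow> bool"
  where "pure_module T \<longleftrightarrow> (\<forall>x. (\<lambda>l. (P_map T ^^ l) (\<lambda>y. y) x) \<longlonglongrightarrow> 0)"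

text \<open>
  Modules are packaged as records so that the function spaces \<open>DA E\<close> below and an abstract
  Hilbert module can occur in the same sequence.
\<close>

record ('h, 'm) hmod =
  mcarrier :: "'h set"
  mzero :: 'h
  mplus :: "'h \<Rightarrow> 'h \<Rightarrow> 'h"
  mscale :: "complex \<Rightarrow> 'h \<Rightarrow> 'h"
  minner :: "'h \<Rightarrow> 'h \<Rightarrow> complex"
  mact :: "'m \<Rightarrow> 'h \<Rightarrow> 'h"

definition module_of :: "('m::finite \<Rightarrow> 'h::complex_hilbert \<Rightarrow> 'h) \<Rightarrow> ('h, 'm) hmod"
  where "module_of T = \<lparr>mcarrier = UNIV, mzero = 0, mplus = (+), mscale = scaleC,
    minner = cinner, mact = T\<rparr>"

definition mnorm :: "('h, 'm) hmod \<Rightarrow> 'h \<Rightarrow> real"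
  where "mnorm A x = sqrt (Re (minner A x x))"

definition module_map :: "('h, 'm) hmod \<Rightarrow> ('k, 'm) hmod \<Rightarrow> ('h \<Rightarrow> 'k) \<Rightarrow> bool"
  where "module_map A B X \<longleftrightarrow>
    (\<forall>x\<in>mcarrier A. X x \<in> mcarrier B) \<and>
    (\<forall>x\<in>mcarrier A. \<forall>y\<in>mcarrier A. X (mplus A x y) = mplus B (X x) (X y)) \<and>
    (\<forall>c. \<forall>x\<in>mcarrier A. X (mscale A c x) = mscale B c (X x)) \<and>
    (\<exists>C. \<forall>x\<in>mcarrier A. mnorm B (X x) \<le> C * mnorm A x) \<and>
    (\<forall>i. \<forall>x\<in>mcarrier A. X (mact A i x) = mact B i (X x))"

definition mkernel :: "('h, 'm) hmod \<Rightarrow> ('k, 'm) hmod \<Rightarrow> ('h \<Rightarrow> 'k) \<Rightarrow> 'h set"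
  where "mkernel A B X = {x \<in> mcarrier A. X x = mzero B}"

text \<open>\<open>X X\<^sup>* = I\<close>, where \<open>Y\<close> is the adjoint \<open>X\<^sup>*\<close>.\<close>

definition coisometric :: "('h, 'm) hmod \<Rightarrow> ('k, 'm) hmod \<Rightarrow> ('h \<Rightarrow> 'k) \<Rightarrow> bool"
  where "coisometric A B X \<longleftrightarrow> (\<exists>Y.
    (\<forall>y\<in>mcarrier B. Y y \<in> mcarrier A) \<and>
    (\<forall>x\<in>mcarrier A. \<forall>y\<in>mcarrier B. minner B (X x) y = minner A x (Y y)) \<and>
    (\<forall>y\<in>mcarrier B. X (Y y) = y))"

text \<open>Isometric on the orthogonal complement of the kernel.\<close>

definition partial_isometry :: "('h, 'm) hmod \<Rightarrow> ('k, 'm) hmod \<Rightarrow> ('h \<Rightarrow> 'k) \<Rightarrow> bool"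
  where "partial_isometry A B X \<longleftrightarrow>
    (\<forall>x\<in>mcarrier A. (\<forall>y\<in>mkernel A B X. minner A x y = 0) \<longrightarrow> mnorm B (X x) = mnorm A x)"

definition unitary_module_map :: "('h, 'm) hmod \<Rightarrow> ('k, 'm) hmod \<Rightarrow> ('h \<Rightarrow> 'k) \<Rightarrow> bool"
  where "unitary_module_map A B U \<longleftrightarrow> module_map A B U \<and>
    bij_betw U (mcarrier A) (mcarrier B) \<and>
    (\<forall>x\<in>mcarrier A. \<forall>y\<in>mcarrier A. minner B (U x) (U y) = minner A x y)"


section \<open>The Drury--Arveson module with coefficients in a Hilbert space\<close>

definition monomial :: "('m::finite \<Rightarrow> nat) \<Rightarrow> complex ^ 'm \<Rightarrow> complex"
  where "monomial k z = (\<Prod>i\<in>UNIV. (z $ i) ^ k i)"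

definition da_weight :: "('m::finite \<Rightarrow> nat) \<Rightarrow> real"
  where "da_weight k = (\<Prod>i\<in>UNIV. fact (k i)) / fact (\<Sum>i\<in>UNIV. k i)"

text \<open>
  Functions on the open unit ball are represented by functions on the whole space which vanish
  off the ball.
\<close>

definition da_expansion ::
  "(('m::finite \<Rightarrow> nat) \<Rightarrow> 'e::complex_hilbert) \<Rightarrow> (complex ^ 'm \<Rightarrow> 'e) \<Rightarrow> bool"
  where "da_expansion a f \<longleftrightarrow>
    (\<lambda>k. (norm (a k))\<^sup>2 * da_weight k) summable_on UNIV \<and>
    (\<forall>z\<in>ball 0 1. ((\<lambda>k. monomial k z *\<^sub>C a k) has_sum f z) UNIV) \<and>
    (\<forall>z. z \<notin> ball 0 1 \<longrightarrow> f z = 0)"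

text \<open>The power series coefficients of a function are unique if they exist.\<close>

definition da_coeff ::
  "(complex ^ 'm::finite \<Rightarrow> 'e::complex_hilbert) \<Rightarrow> ('m \<Rightarrow> nat) \<Rightarrow> 'e"
  where "da_coeff f = (THE a. da_expansion a f)"

definition DA :: "'e::complex_hilbert set \<Rightarrow> (complex ^ 'm::finite \<Rightarrow> 'e, 'm) hmod"
  where "DA E = \<lparr>
    mcarrier = {f. \<exists>a. (\<forall>k. a k \<in> E) \<and> da_expansion a f},
    mzero = (\<lambda>z. 0),
    mplus = (\<lambda>f g z. f z + g z),
    mscale = (\<lambda>c f z. c *\<^sub>C f z),
    minner = (\<lambda>f g. \<Sum>\<^sub>\<infinity>k. complex_of_real (da_weight k) * cinner (da_coeff f k) (da_coeff g k)),
    mact = (\<lambda>i f z. (z $ i) *\<^sub>C f z)\<rparr>"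


section \<open>Multipliers\<close>

text \<open>
  \<open>L(E,F)\<close>: a bounded operator from the subspace \<open>E\<close> to the subspace \<open>F\<close> is extended by zero
  on the orthogonal complement of \<open>E\<close>, which does not change its norm.
\<close>

definition Lspace ::
  "'a::complex_hilbert set \<Rightarrow> 'b::complex_hilbert set \<Rightarrow> ('a \<Rightarrow>\<^sub>L 'b) set"
  where "Lspace E F = {A. clinear (blinfun_apply A) \<and> (\<forall>x\<in>E. blinfun_apply A x \<in> F) \<and>
    (\<forall>x. (\<forall>y\<in>E. cinner x y = 0) \<longrightarrow> blinfun_apply A x = 0)}"

text \<open>Complex Frechet differentiability in the operator norm at every point of the ball.\<close>

definition holomorphic_on_ball ::
  "(complex ^ 'm::finite \<Rightarrow> ('a::complex_hilbert \<Rightarrow>\<^sub>L 'b::complex_hilbert)) \<Rightarrow> bool"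
  where "holomorphic_on_ball \<phi> \<longleftrightarrow> (\<forall>z\<in>ball 0 1. \<exists>D. (\<phi> has_derivative D) (at z) \<and>
    (\<forall>c v x. blinfun_apply (D (c *s v)) x = c *\<^sub>C blinfun_apply (D v) x))"

text \<open>
  The product vanishes off the ball with \<open>f\<close>; values of \<open>\<phi>\<close> off the ball are irrelevant.
\<close>

definition mult_op ::
  "(complex ^ 'm::finite \<Rightarrow> ('a::complex_hilbert \<Rightarrow>\<^sub>L 'b::complex_hilbert)) \<Rightarrow>
    (complex ^ 'm \<Rightarrow> 'a) \<Rightarrow> complex ^ 'm \<Rightarrow> 'b"
  where "mult_op \<phi> f = (\<lambda>z. blinfun_apply (\<phi> z) (f z))"

definition multiplier ::
  "'a::complex_hilbert set \<Rightarrow> 'b::complex_hilbert set \<Rightarrow>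
    (complex ^ 'm::finite \<Rightarrow> ('a \<Rightarrow>\<^sub>L 'b)) \<Rightarrow> bool"
  where "multiplier E F \<phi> \<longleftrightarrow> (\<forall>z\<in>ball 0 1. \<phi> z \<in> Lspace E F) \<and> holomorphic_on_ball \<phi> \<and>
    (\<forall>f\<in>mcarrier (DA E). mult_op \<phi> f \<in> mcarrier (DA F))"

definition inner_multiplier ::
  "'a::complex_hilbert set \<Rightarrow> 'b::complex_hilbert set \<Rightarrow>
    (complex ^ 'm::finite \<Rightarrow> ('a \<Rightarrow>\<^sub>L 'b)) \<Rightarrow> bool"
  where "inner_multiplier E F \<phi> \<longleftrightarrow> multiplier E F \<phi> \<and>
    partial_isometry (DA E) (DA F) (mult_op \<phi>)"


section \<open>Resolutions\<close>

text \<open>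
  The sequence \<open>\<dots> \<rightarrow> DA (E 1) \<rightarrow> DA (E 0) \<rightarrow> M \<rightarrow> 0\<close>, where \<open>E = coef_space R\<close>,
  \<open>M = resolved R\<close>, the map \<open>X\<^sub>k\<close> out of \<open>DA (E k)\<close> is \<open>conn R k\<close> for \<open>k \<ge> 1\<close> and \<open>X\<^sub>0\<close>
  is \<open>aug R\<close>. The value \<open>conn R 0\<close> has no meaning. A sequence that starts on the left with
  \<open>0 \<rightarrow> DA (E N)\<close> has \<open>E k = {0}\<close> for all \<open>k > N\<close>. Hence sequences that differ only by zero
  modules on the left are identified, and a length of a resolution is any such \<open>N\<close>.
\<close>

record ('m, 'e, 'h) resolution =
  coef_space :: "nat \<Rightarrow> 'e set"
  conn :: "nat \<Rightarrow> (complex ^ 'm \<Rightarrow> 'e) \<Rightarrow> (complex ^ 'm \<Rightarrow> 'e)"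
  aug :: "(complex ^ 'm \<Rightarrow> 'e) \<Rightarrow> 'h"
  resolved :: "('h, 'm) hmod"

definition exact_resolution ::
  "('m::finite, 'e::complex_hilbert, 'h) resolution \<Rightarrow> bool"
  where "exact_resolution R \<longleftrightarrow> (let H = (\<lambda>k. DA (coef_space R k)); M = resolved R in
    aug R ` mcarrier (H 0) = mcarrier M \<and>
    conn R 1 ` mcarrier (H 1) = mkernel (H 0) M (aug R) \<and>
    (\<forall>k\<ge>1. conn R (Suc k) ` mcarrier (H (Suc k)) = mkernel (H k) (H (k - 1)) (conn R k)))"

definition finite_inner_resolution ::
  "nat \<Rightarrow> ('m::finite, 'e::complex_hilbert, 'h) resolution \<Rightarrow> bool"
  where "finite_inner_resolution N R \<longleftrightarrow> (let E = coef_space R in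
    (\<forall>k. hilbert_subspace (E k)) \<and> (\<forall>k>N. E k = {0}) \<and>
    (\<forall>k\<ge>1. \<exists>\<phi>. inner_multiplier (E k) (E (k - 1)) \<phi> \<and>
      (\<forall>f\<in>mcarrier (DA (E k)). conn R k f = mult_op \<phi> f)) \<and>
    module_map (DA (E 0)) (resolved R) (aug R) \<and>
    coisometric (DA (E 0)) (resolved R) (aug R) \<and>
    exact_resolution R)"

text \<open>
  \<open>R'\<close> is the trivial extension by \<open>F\<close> of \<open>R\<close>, considered as a resolution of length \<open>N\<close>.
  The new term in position \<open>N\<close> is the direct sum of \<open>F\<close> and \<open>coef_space R N\<close>, with inclusions
  \<open>i\<close> and \<open>j\<close>.
  Since \<open>coef_space R N\<close> may be zero, extensions may be preceded by zero modules:
  for instance \<open>0 \<rightarrow> DA F \<rightarrow> DA F \<rightarrow> DA E \<rightarrow> DA E \<rightarrow> 0\<close>, with maps \<open>I\<close>, \<open>0\<close>, \<open>I\<close>, extends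
  \<open>0 \<rightarrow> 0 \<rightarrow> DA E \<rightarrow> DA E \<rightarrow> 0\<close>.
\<close>

definition trivial_extension ::
  "('m::finite, 'e::complex_hilbert, 'h) resolution \<Rightarrow> 'e set \<Rightarrow>
    ('m, 'e, 'h) resolution \<Rightarrow> bool"
  where "trivial_extension R F R' \<longleftrightarrow> (\<exists>N S i j.
    (\<forall>k>N. coef_space R k = {0}) \<and> F \<noteq> {0} \<and> direct_sum F (coef_space R N) S i j \<and>
    coef_space R' = (coef_space R)(N := S, Suc N := F) \<and>
    resolved R' = resolved R \<and>
    (\<forall>f\<in>mcarrier (DA F). conn R' (Suc N) f = (\<lambda>z. i (f z))) \<and>
    (\<forall>f\<in>mcarrier (DA F). \<forall>g\<in>mcarrier (DA (coef_space R N)).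
      (if N = 0 then aug R' (\<lambda>z. i (f z) + j (g z)) = aug R g
       else conn R' N (\<lambda>z. i (f z) + j (g z)) = conn R N g)) \<and>
    (\<forall>k\<ge>1. k \<noteq> N \<longrightarrow> k \<noteq> Suc N \<longrightarrow>
      (\<forall>f\<in>mcarrier (DA (coef_space R k)). conn R' k f = conn R k f)) \<and>
    (N \<noteq> 0 \<longrightarrow> (\<forall>f\<in>mcarrier (DA (coef_space R 0)). aug R' f = aug R f)))"

text \<open>The sequence \<open>0 \<rightarrow> DA E \<rightarrow> DA E \<rightarrow> 0\<close> with the identity map.\<close>

definition identity_resolution ::
  "'e::complex_hilbert set \<Rightarrow> ('m::finite, 'e, complex ^ 'm \<Rightarrow> 'e) resolution"
  where "identity_resolution E = \<lparr>
    coef_space = (\<lambda>k. if k = 0 then E else {0}),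
    conn = (\<lambda>k f z. 0),
    aug = (\<lambda>f. f),
    resolved = DA E\<rparr>"

inductive iterated_trivial_extension ::
  "('m::finite, 'e::complex_hilbert, complex ^ 'm \<Rightarrow> 'e) resolution \<Rightarrow> bool"
  where
    base: "hilbert_subspace E \<Longrightarrow> iterated_trivial_extension (identity_resolution E)"
  | step: "iterated_trivial_extension R \<Longrightarrow> trivial_extension R F R' \<Longrightarrow>
      iterated_trivial_extension R'"

definition equivalent_resolutions ::
  "('m::finite, 'e::complex_hilbert, 'h) resolution \<Rightarrow>
    ('m, 'f::complex_hilbert, 'k) resolution \<Rightarrow> bool"
  where "equivalent_resolutions R R' \<longleftrightarrow> (let H = (\<lambda>k. DA (coef_space R k));
      H' = (\<lambda>k. DA (coef_space R' k)) in
    (\<exists>U V. (\<forall>k. unitary_module_map (H k) (H' k) (U k)) \<and>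
      unitary_module_map (resolved R) (resolved R') V \<and>
      (\<forall>k\<ge>1. \<forall>f\<in>mcarrier (H k). U (k - 1) (conn R k f) = conn R' k (U k f)) \<and>
      (\<forall>f\<in>mcarrier (H 0). V (aug R f) = aug R' (U 0 f))))"

definition trivial_inner_resolution ::
  "('m::finite, 'e::complex_hilbert, 'h) resolution \<Rightarrow> bool"
  where "trivial_inner_resolution R \<longleftrightarrow>
    (\<exists>R' :: ('m, 'e, complex ^ 'm \<Rightarrow> 'e) resolution.
      iterated_trivial_extension R' \<and> equivalent_resolutions R R')"

end

theory Submission
  imports Defs
begin

text \<open>
  The heart of the matter is a rigidity property of the Drury--Arveson space in \<open>m > 1\<close>
  variables: an isometric multiplier is constant. If \<open>M\<^sub>\<phi>\<close> is isometric and \<open>f = \<phi> x\<close> is the image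
  of a constant \<open>x\<close>, then \<open>\<parallel>z\<^sub>i f\<parallel> = \<parallel>z\<^sub>i x\<parallel> = \<parallel>x\<parallel> = \<parallel>f\<parallel>\<close> for every \<open>i\<close>. Multiplication by \<open>z\<^sub>i\<close>
  multiplies the squared norm of the monomial \<open>z\<^sup>k\<close> by \<open>(k\<^sub>i + 1) / (\<bar>k\<bar> + 1)\<close>, which is smaller than
  \<open>1\<close> unless \<open>z\<^sup>k\<close> is a power of \<open>z\<^sub>i\<close>. Only a constant is a power of two different coordinates at
  once, so \<open>f\<close> is constant (lemma \<open>constant_if_coordinates_preserve_norm\<close>).

  Now descend along a finite inner resolution. Its last nonzero map \<open>X\<^sub>N\<close> is injective, hence
  isometric, hence composition with a constant isometry, and its range is \<open>H\<^sup>2 \<otimes> G\<close> for a closed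
  subspace \<open>G\<close> of the next coefficient space. By exactness this range is the kernel of \<open>X\<^sub>N\<^sub>-\<^sub>1\<close>, which
  is therefore isometric on \<open>H\<^sup>2 \<otimes> (E \<ominus> G)\<close>, and the argument repeats (lemmas
  \<open>inner_multiplier_constant\<close> and \<open>inner_multiplier_range\<close>). All connecting maps are thus
  compositions with constant partial isometries \<open>B\<^sub>k\<close>, every coefficient space splits as
  \<open>E\<^sub>k = B\<^sub>k F\<^sub>k\<^sub>+\<^sub>1 \<oplus> F\<^sub>k\<close>, and \<open>B\<^sub>k\<close> is isometric on \<open>F\<^sub>k\<^sub>+\<^sub>1\<close> and kills the complement of
  \<open>F\<^sub>k\<^sub>+\<^sub>1\<close> in \<open>E\<^sub>k\<^sub>+\<^sub>1\<close>. The co-isometry \<open>X\<^sub>0\<close> identifies the resolved module with \<open>H\<^sup>2 \<otimes> F\<^sub>0\<close>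
  (lemma \<open>coisometric_adjoint_unitary\<close>). Starting from the identity resolution of \<open>H\<^sup>2 \<otimes> F\<^sub>0\<close>, the
  trivial extensions by those among \<open>F\<^sub>1, F\<^sub>2, \<dots>\<close> that are nonzero rebuild the given sequence
  (lemma \<open>represents_step\<close>).
\<close>


section \<open>Complex Hilbert spaces\<close>

lemma scaleC_zero_left [simp]: "0 *\<^sub>C (x::'a::complex_hilbert) = 0"
  using scaleC_add_left[of 0 0 x] by simp

lemma scaleC_zero_right [simp]: "c *\<^sub>C (0::'a::complex_hilbert) = 0"
  using scaleC_add_right[of c 0 "0::'a"] by simp

lemma scaleC_one [simp]: "1 *\<^sub>C (x::'a::complex_hilbert) = x"
  using scaleC_of_real[of 1 x] by simp

lemma scaleC_minus_one: "(- 1) *\<^sub>C (x::'a::complex_hilbert) = - x"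
  using scaleC_of_real[of "-1" x] by simp

lemma scaleC_minus_right: "c *\<^sub>C (- (x::'a::complex_hilbert)) = - (c *\<^sub>C x)"
  using scaleC_add_right[of c x "-x"] by (simp add: eq_neg_iff_add_eq_0 add.commute)

lemma scaleC_diff_right: "c *\<^sub>C ((x::'a::complex_hilbert) - y) = c *\<^sub>C x - c *\<^sub>C y"
  using scaleC_add_right[of c x "-y"] by (simp add: scaleC_minus_right)

lemma cinner_scaleC_right: "cinner (x::'a::complex_hilbert) (c *\<^sub>C y) = cnj c * cinner x y"
  by (metis cinner_commute cinner_scaleC_left complex_cnj_mult)

lemma cinner_add_right: "cinner (x::'a::complex_hilbert) (y + z) = cinner x y + cinner x z"
  by (metis cinner_commute cinner_add_left complex_cnj_add)

lemma cinner_zero_left [simp]: "cinner 0 (x::'a::complex_hilbert) = 0"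
  using cinner_add_left[of 0 0 x] by simp

lemma cinner_zero_right [simp]: "cinner (x::'a::complex_hilbert) 0 = 0"
  using cinner_add_right[of x 0 0] by simp

lemma cinner_diff_left: "cinner ((x::'a::complex_hilbert) - y) z = cinner x z - cinner y z"
  using cinner_add_left[of "x - y" y z] by simp

lemma cinner_eq_Complex:
  "cinner (x::'a::complex_hilbert) y = Complex (inner x y) (inner x (\<i> *\<^sub>C y))"
proof -
  have "inner x (\<i> *\<^sub>C y) = Re (cinner x (\<i> *\<^sub>C y))"
    by (simp add: Re_cinner)
  also have "\<dots> = Im (cinner x y)"
    by (simp add: cinner_scaleC_right)
  finally show ?thesis
    by (simp add: complex_eq_iff Re_cinner)
qed

lemma cinner_self: "cinner (x::'a::complex_hilbert) x = complex_of_real ((norm x)\<^sup>2)"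
proof -
  have "Im (cinner x x) = 0"
    using arg_cong[OF cinner_commute[of x x], of Im] by simp
  moreover have "Re (cinner x x) = (norm x)\<^sup>2"
    by (simp add: Re_cinner power2_norm_eq_inner)
  ultimately show ?thesis
    by (simp add: complex_eq_iff)
qed

lemma cinner_self_eq_0 [simp]: "cinner (x::'a::complex_hilbert) x = 0 \<longleftrightarrow> x = 0"
  by (simp add: cinner_self)

lemma cinner_eq_0_commute: "cinner (x::'a::complex_hilbert) y = 0 \<longleftrightarrow> cinner y x = 0"
  by (metis cinner_commute complex_cnj_zero)

lemma norm_scaleC: "norm (c *\<^sub>C (x::'a::complex_hilbert)) = cmod c * norm x"
proof -
  have "complex_of_real ((norm (c *\<^sub>C x))\<^sup>2) = c * cnj c * complex_of_real ((norm x)\<^sup>2)"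
    by (simp only: cinner_self[symmetric] cinner_scaleC_left cinner_scaleC_right mult_ac)
  also have "\<dots> = complex_of_real ((cmod c * norm x)\<^sup>2)"
    by (simp only: complex_norm_square[symmetric] power_mult_distrib of_real_mult of_real_power)
  finally have "(norm (c *\<^sub>C x))\<^sup>2 = (cmod c * norm x)\<^sup>2"
    by (simp only: of_real_eq_iff)
  then show ?thesis
    by (simp add: power2_eq_iff_nonneg)
qed

lemma bounded_linear_scaleC: "bounded_linear (\<lambda>x::'a::complex_hilbert. c *\<^sub>C x)"
proof
  show "c *\<^sub>C (x + y) = c *\<^sub>C x + c *\<^sub>C y" for x y :: 'a
    by (rule scaleC_add_right)
  show "c *\<^sub>C (r *\<^sub>R x) = r *\<^sub>R (c *\<^sub>C x)" for r and x :: 'a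
    by (simp add: scaleC_of_real[symmetric] scaleC_scaleC mult.commute)
  show "\<exists>K. \<forall>x::'a. norm (c *\<^sub>C x) \<le> norm x * K"
    by (rule exI[of _ "cmod c"]) (simp add: norm_scaleC mult.commute)
qed

lemma bounded_linear_cinner: "bounded_linear (\<lambda>x::'a::complex_hilbert. cinner x y)"
proof -
  have "bounded_linear (\<lambda>x. complex_of_real (inner x y) + \<i> * complex_of_real (inner x (\<i> *\<^sub>C y)))"
    by (intro bounded_linear_add bounded_linear_const_mult bounded_linear_compose[OF bounded_linear_of_real]
        bounded_linear_inner_left)
  moreover have "cinner x y = complex_of_real (inner x y) + \<i> * complex_of_real (inner x (\<i> *\<^sub>C y))" for x
    by (simp add: cinner_eq_Complex complex_eq_iff)
  ultimately show ?thesis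
    by simp
qed

lemma bounded_clinearD:
  assumes "bounded_clinear A"
  shows "A (x + y) = A x + A y" "A (c *\<^sub>C x) = c *\<^sub>C A x" "bounded_linear A"
    "A 0 = 0" "A (x - y) = A x - A y"
  using assms by (auto simp: bounded_clinear_def clinear_def linear_simps)

lemma bounded_clinearI:
  assumes "\<And>x y. A (x + y) = A x + A y" "\<And>c x. A (c *\<^sub>C x) = c *\<^sub>C A x"
    and "\<And>x. norm (A x) \<le> norm x * K"
  shows "bounded_clinear A"
  unfolding bounded_clinear_def clinear_def
proof (intro conjI allI)
  show "bounded_linear A"
  proof (rule bounded_linear_intro)
    show "A (r *\<^sub>R x) = r *\<^sub>R A x" for r x
      using assms(2)[of "complex_of_real r" x] by (simp add: scaleC_of_real)
  qed (use assms in auto)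
qed (use assms in auto)

text \<open>Polarization, applied to \<open>x, y\<close> for the real part and to \<open>x, \<i> y\<close> for the imaginary part.\<close>

lemma cinner_isometric:
  assumes "clinear A"
    and add: "\<And>x y. x \<in> F \<Longrightarrow> y \<in> F \<Longrightarrow> x + y \<in> F" and sc: "\<And>c x. x \<in> F \<Longrightarrow> c *\<^sub>C x \<in> F"
    and iso: "\<And>x. x \<in> F \<Longrightarrow> norm (A x) = norm x"
    and xy: "x \<in> F" "y \<in> F"
  shows "cinner (A x) (A y) = cinner x y"
proof -
  have re: "inner (A u) (A v) = inner u v" if "u \<in> F" "v \<in> F" for u v
  proof -
    have "(norm (A u + A v))\<^sup>2 = (norm (u + v))\<^sup>2"
      using iso[OF add[OF that]] assms(1) by (simp add: clinear_def)
    moreover have "(norm (A u))\<^sup>2 = (norm u)\<^sup>2" "(norm (A v))\<^sup>2 = (norm v)\<^sup>2"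
      using iso that by auto
    ultimately show ?thesis
      by (simp add: power2_norm_eq_inner inner_add_left inner_add_right inner_commute)
  qed
  have "A (\<i> *\<^sub>C y) = \<i> *\<^sub>C A y"
    using assms(1) by (simp add: clinear_def)
  then show ?thesis
    using re[OF xy] re[OF xy(1) sc[OF xy(2)], of \<i>] by (simp add: cinner_eq_Complex)
qed


section \<open>Closed subspaces and orthogonal projections\<close>

lemma hilbert_subspaceD:
  assumes "hilbert_subspace E"
  shows "0 \<in> E" "x \<in> E \<Longrightarrow> y \<in> E \<Longrightarrow> x + y \<in> E" "x \<in> E \<Longrightarrow> c *\<^sub>C x \<in> E" "closed E"
    "x \<in> E \<Longrightarrow> y \<in> E \<Longrightarrow> x - y \<in> E" "x \<in> E \<Longrightarrow> r *\<^sub>R x \<in> E"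
proof -
  show "0 \<in> E" "closed E" and add: "x \<in> E \<Longrightarrow> y \<in> E \<Longrightarrow> x + y \<in> E" for x y
    using assms by (auto simp: hilbert_subspace_def)
  show sc: "x \<in> E \<Longrightarrow> c *\<^sub>C x \<in> E" for c x
    using assms by (auto simp: hilbert_subspace_def)
  show "x \<in> E \<Longrightarrow> y \<in> E \<Longrightarrow> x - y \<in> E"
    using add[of x "(-1) *\<^sub>C y"] sc[of y "-1"] by (simp add: scaleC_minus_one)
  show "x \<in> E \<Longrightarrow> r *\<^sub>R x \<in> E"
    using sc[of x "complex_of_real r"] by (simp add: scaleC_of_real)
qed

lemma hilbert_subspace_zero: "hilbert_subspace {0}"
  by (auto simp: hilbert_subspace_def)

text \<open>This is \<open>E \<ominus> G\<close>, but \<open>G\<close> need not be contained in \<open>E\<close>.\<close>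

definition ocompl :: "'a::complex_hilbert set \<Rightarrow> 'a set \<Rightarrow> 'a set"
  where "ocompl E G = {x \<in> E. \<forall>y\<in>G. cinner x y = 0}"

lemma hilbert_subspace_ocompl:
  assumes "hilbert_subspace E"
  shows "hilbert_subspace (ocompl E G)"
proof -
  have "closed {x. cinner x y = 0}" for y :: 'a
    by (intro closed_Collect_eq continuous_intros bounded_linear.continuous_on[OF bounded_linear_cinner])
  moreover have "ocompl E G = E \<inter> (\<Inter>y\<in>G. {x. cinner x y = 0})"
    by (auto simp: ocompl_def)
  ultimately have "closed (ocompl E G)"
    using hilbert_subspaceD(4)[OF assms] by auto
  then show ?thesis
    using assms by (auto simp: hilbert_subspace_def ocompl_def cinner_add_left cinner_scaleC_left)
qed

text \<open>
  Near-minimizers of the distance from \<open>x\<close> to \<open>F\<close> are close to each other by the parallelogram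
  law, so completeness yields a minimizer; minimality forces orthogonality.
\<close>

lemma orthogonal_projection_exists:
  fixes x :: "'a::complex_hilbert"
  assumes F: "hilbert_subspace F"
  shows "\<exists>p\<in>F. \<forall>y\<in>F. cinner (x - p) y = 0"
proof -
  note F' = hilbert_subspaceD[OF F]
  define D where "D = (INF y\<in>F. (norm (x - y))\<^sup>2)"
  have bdd: "bdd_below ((\<lambda>y. (norm (x - y))\<^sup>2) ` F)"
    by (rule bdd_belowI[of _ 0]) auto
  have D: "D \<le> (norm (x - y))\<^sup>2" if "y \<in> F" for y
    unfolding D_def by (rule cINF_lower[OF bdd that])
  \<comment> \<open>The near-minimizers form a nested sequence of closed sets whose diameters tend to zero.\<close>
  define S where "S = (\<lambda>n::nat. F \<inter> {y. (norm (x - y))\<^sup>2 \<le> D + 1 / real (Suc n)})"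
  have "\<exists>p. \<forall>n. p \<in> S n"
  proof (rule decreasing_closed_nest)
    fix n
    have "closed {y. (norm (x - y))\<^sup>2 \<le> D + 1 / real (Suc n)}"
      by (intro closed_Collect_le continuous_intros)
    then show "closed (S n)"
      unfolding S_def using F'(4) by auto
    have "\<exists>y\<in>F. (norm (x - y))\<^sup>2 < D + 1 / real (Suc n)"
      using cINF_less_iff[OF _ bdd, of "D + 1 / real (Suc n)"] F'(1) unfolding D_def[symmetric]
      by auto
    then show "S n \<noteq> {}"
      by (auto simp: S_def intro: less_imp_le)
  next
    fix m n :: nat assume "m \<le> n"
    then have "1 / real (Suc n) \<le> 1 / real (Suc m)"
      by (simp add: frac_le)
    then show "S n \<subseteq> S m"
      by (auto simp: S_def)
  next
    fix e :: real assume e: "e > 0"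
    obtain n where n: "1 / real (Suc n) < e\<^sup>2 / 4"
      using e by (metis nat_approx_posE of_nat_Suc zero_less_divide_iff zero_less_numeral zero_less_power)
    have "dist y z < e" if "y \<in> S n" "z \<in> S n" for y z
    proof -
      have yz: "y \<in> F" "z \<in> F" "(norm (x - y))\<^sup>2 \<le> D + 1 / real (Suc n)"
        "(norm (x - z))\<^sup>2 \<le> D + 1 / real (Suc n)"
        using that by (auto simp: S_def)
      have "(1/2) *\<^sub>R (y + z) \<in> F"
        using yz F' by auto
      then have mid: "D \<le> (norm (x - (1/2) *\<^sub>R (y + z)))\<^sup>2"
        by (rule D)
      have "(norm (y - z))\<^sup>2 =
        2 * (norm (x - y))\<^sup>2 + 2 * (norm (x - z))\<^sup>2 - 4 * (norm (x - (1/2) *\<^sub>R (y + z)))\<^sup>2"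
        unfolding power2_norm_eq_inner
        by (simp add: inner_diff_left inner_diff_right inner_add_left inner_add_right
            inner_commute algebra_simps)
      also have "\<dots> \<le> 4 * (1 / real (Suc n))"
        using yz mid by linarith
      also have "\<dots> < e\<^sup>2"
        using n by linarith
      finally show ?thesis
        using e by (simp add: dist_norm power_less_imp_less_base)
    qed
    then show "\<exists>n. \<forall>y\<in>S n. \<forall>z\<in>S n. dist y z < e"
      by blast
  qed blast
  then obtain p where p: "\<And>n. p \<in> S n"
    by blast
  have pF: "p \<in> F"
    using p[of 0] by (simp add: S_def)
  have pD: "(norm (x - p))\<^sup>2 \<le> D"
  proof (rule field_le_epsilon)
    fix e :: real assume "e > 0"
    then obtain n where "1 / real (Suc n) < e"
      by (metis nat_approx_posE of_nat_Suc)
    then show "(norm (x - p))\<^sup>2 \<le> D + e"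
      using p[of n] by (simp add: S_def)
  qed
  have re: "inner (x - p) y = 0" if "y \<in> F" for y
  proof (cases "y = 0")
    case False
    \<comment> \<open>The real multiple of \<open>y\<close> for which \<open>p + t y\<close> is closest to \<open>x\<close>.\<close>
    define t where "t = inner (x - p) y / (norm y)\<^sup>2"
    have "D \<le> (norm (x - (p + t *\<^sub>R y)))\<^sup>2"
      using F' pF that by (intro D) auto
    also have "\<dots> = (norm (x - p))\<^sup>2 - 2 * t * inner (x - p) y + t\<^sup>2 * (norm y)\<^sup>2"
      unfolding power2_norm_eq_inner
      by (simp add: inner_diff_left inner_diff_right inner_add_left inner_add_right
          inner_commute algebra_simps power2_eq_square)
    also have "\<dots> = (norm (x - p))\<^sup>2 - t * inner (x - p) y"
      using False by (simp add: t_def power2_eq_square)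
    finally have "(inner (x - p) y)\<^sup>2 / (norm y)\<^sup>2 \<le> 0"
      using pD by (simp add: t_def power2_eq_square)
    moreover have "(inner (x - p) y)\<^sup>2 / (norm y)\<^sup>2 \<ge> 0"
      by simp
    ultimately have "(inner (x - p) y)\<^sup>2 / (norm y)\<^sup>2 = 0"
      by linarith
    then show ?thesis
      using False by simp
  qed simp
  have "cinner (x - p) y = 0" if "y \<in> F" for y
    using re[OF that] re[OF F'(3)[OF that], of \<i>] by (simp add: cinner_eq_Complex complex_eq_iff)
  with pF show ?thesis
    by blast
qed

definition oproj :: "'a::complex_hilbert set \<Rightarrow> 'a \<Rightarrow> 'a"
  where "oproj F x = (SOME p. p \<in> F \<and> (\<forall>y\<in>F. cinner (x - p) y = 0))"

lemma oproj:
  assumes "hilbert_subspace F"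
  shows oproj_in: "oproj F x \<in> F" and oproj_orth: "y \<in> F \<Longrightarrow> cinner (x - oproj F x) y = 0"
proof -
  have "\<exists>p. p \<in> F \<and> (\<forall>y\<in>F. cinner (x - p) y = 0)"
    using orthogonal_projection_exists[OF assms, of x] by blast
  from someI_ex[OF this] show "oproj F x \<in> F" "y \<in> F \<Longrightarrow> cinner (x - oproj F x) y = 0"
    by (auto simp: oproj_def)
qed

lemma oproj_eqI:
  assumes F: "hilbert_subspace F" and "p \<in> F" and "\<And>y. y \<in> F \<Longrightarrow> cinner (x - p) y = 0"
  shows "oproj F x = p"
proof -
  let ?d = "oproj F x - p"
  have "?d \<in> F"
    using assms oproj_in[OF F] hilbert_subspaceD[OF F] by auto
  then have "cinner (x - p) ?d - cinner (x - oproj F x) ?d = 0"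
    using assms(3) oproj_orth[OF F] by simp
  then have "cinner ?d ?d = 0"
    by (simp add: cinner_diff_left[symmetric])
  then show ?thesis
    by simp
qed

lemma oproj_ident: "hilbert_subspace F \<Longrightarrow> x \<in> F \<Longrightarrow> oproj F x = x"
  by (rule oproj_eqI) auto

lemma bounded_clinear_oproj:
  assumes F: "hilbert_subspace F"
  shows "bounded_clinear (oproj F)"
proof (rule bounded_clinearI[where K = 1])
  note F' = hilbert_subspaceD[OF F] and p = oproj[OF F]
  show "oproj F (x + y) = oproj F x + oproj F y" for x y
    by (rule oproj_eqI[OF F])
      (use F' p in \<open>auto simp: add_diff_add cinner_add_left\<close>)
  show "oproj F (c *\<^sub>C x) = c *\<^sub>C oproj F x" for c x
    by (rule oproj_eqI[OF F])
      (use F' p in \<open>auto simp: scaleC_diff_right[symmetric] cinner_scaleC_left\<close>)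
  show "norm (oproj F x) \<le> norm x * 1" for x
  proof -
    have "inner (x - oproj F x) (oproj F x) = 0"
      using p(2)[OF p(1), of x x] by (simp add: cinner_eq_Complex complex_eq_iff)
    then have "(norm (oproj F x))\<^sup>2 = inner x (oproj F x)"
      by (simp add: inner_diff_left power2_norm_eq_inner)
    also have "\<dots> \<le> norm x * norm (oproj F x)"
      by (rule norm_cauchy_schwarz)
    finally show ?thesis
      by (cases "oproj F x = 0") (auto simp: power2_eq_square)
  qed
qed

lemma ocompl_disjoint: "x \<in> G \<Longrightarrow> x \<in> ocompl E G \<Longrightarrow> x = 0"
  using cinner_self_eq_0[of x] by (auto simp: ocompl_def simp del: cinner_self_eq_0)

lemma diff_oproj_in_ocompl:
  assumes G: "hilbert_subspace G" and E: "hilbert_subspace E" and "G \<subseteq> E" "x \<in> E"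
  shows "x - oproj G x \<in> ocompl E G"
  using assms(3,4) oproj_in[OF G, of x] oproj_orth[OF G] hilbert_subspaceD(5)[OF E, of x "oproj G x"]
  by (auto simp: ocompl_def)

lemma oproj_ocompl:
  assumes G: "hilbert_subspace G" and E: "hilbert_subspace E" and "G \<subseteq> E" "x \<in> E"
  shows "oproj (ocompl E G) x = x - oproj G x"
proof (rule oproj_eqI[OF hilbert_subspace_ocompl[OF E] diff_oproj_in_ocompl[OF assms]])
  show "cinner (x - (x - oproj G x)) y = 0" if "y \<in> ocompl E G" for y
    using that oproj_in[OF G, of x] cinner_eq_0_commute[of y] by (auto simp: ocompl_def)
qed

text \<open>
  The image is an isometric copy of the complete space \<open>E \<ominus> G\<close>, and hence it is closed.
\<close>

lemma image_partial_isometry: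
  assumes G: "hilbert_subspace G" and E: "hilbert_subspace E" and GE: "G \<subseteq> E"
    and A: "bounded_clinear A"
    and ker: "\<And>x. x \<in> G \<Longrightarrow> A x = 0"
    and iso: "\<And>x. x \<in> ocompl E G \<Longrightarrow> norm (A x) = norm x"
  shows "A ` E = A ` ocompl E G" and "hilbert_subspace (A ` E)"
proof -
  note A' = bounded_clinearD[OF A]
  let ?F = "ocompl E G"
  note F = hilbert_subspace_ocompl[OF E, of G] and E' = hilbert_subspaceD[OF E]
  show eq: "A ` E = A ` ?F"
  proof
    show "A ` E \<subseteq> A ` ?F"
    proof
      fix y assume "y \<in> A ` E"
      then obtain x where x: "x \<in> E" "y = A x"
        by auto
      then have "y = A (x - oproj G x)"
        using ker[OF oproj_in[OF G]] A'(5) by simp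
      then show "y \<in> A ` ?F"
        using diff_oproj_in_ocompl[OF G E GE x(1)] by auto
    qed
  qed (auto simp: ocompl_def)
  have "complete (A ` ?F)"
  proof (rule complete_isometric_image[where e = 1])
    show "subspace ?F"
      using hilbert_subspaceD[OF F] by (auto simp: subspace_def)
    show "complete ?F"
      using hilbert_subspaceD(4)[OF F] by (simp add: complete_eq_closed)
  qed (use iso A' in auto)
  then have "closed (A ` E)"
    by (simp add: eq complete_imp_closed)
  then show "hilbert_subspace (A ` E)"
    unfolding hilbert_subspace_def
  proof (intro conjI ballI allI)
    show "0 \<in> A ` E"
      using A'(4) E'(1) by (metis image_eqI)
    show "x + y \<in> A ` E" if "x \<in> A ` E" "y \<in> A ` E" for x y
      using that E'(2) A'(1) by (auto simp: image_iff) metis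
    show "c *\<^sub>C x \<in> A ` E" if "x \<in> A ` E" for c x
      using that E'(3) A'(2) by (auto simp: image_iff) metis
  qed
qed


section \<open>Uniqueness of power series coefficients\<close>

lemma exists_prime_labelling: "\<exists>p :: 'm::finite \<Rightarrow> nat. inj p \<and> (\<forall>i. prime (p i))"
proof -
  obtain B where B: "finite B" "card B = CARD('m)" "B \<subseteq> {p::nat. prime p}"
    using infinite_arbitrarily_large[OF primes_infinite] by blast
  then obtain p where "bij_betw p (UNIV :: 'm set) B"
    using finite_same_card_bij[of "UNIV :: 'm set" B] by auto
  then show ?thesis
    using B(3) by (intro exI[of _ p]) (auto simp: bij_betw_def)
qed

lemma prod_prime_powers_inj:
  fixes p :: "'m::finite \<Rightarrow> nat"
  assumes "inj p" "\<And>i. prime (p i)"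
  shows "inj (\<lambda>k. \<Prod>i\<in>UNIV. p i ^ k i)"
proof (rule injI, rule ext)
  fix k l :: "'m \<Rightarrow> nat" and j
  assume eq: "(\<Prod>i\<in>UNIV. p i ^ k i) = (\<Prod>i\<in>UNIV. p i ^ l i)"
  have "multiplicity (p j) (\<Prod>i\<in>UNIV. p i ^ k i) = k j" for k
  proof -
    have "multiplicity (p j) (\<Prod>i\<in>UNIV. p i ^ k i) = (\<Sum>i\<in>UNIV. multiplicity (p j) (p i ^ k i))"
      using assms by (intro prime_elem_multiplicity_prod_distrib) (auto, metis not_prime_0)
    also have "\<dots> = (\<Sum>i\<in>UNIV. if i = j then k j else 0)"
      using assms
      by (intro sum.cong)
        (auto simp: multiplicity_distinct_prime_power inj_eq intro!: multiplicity_same_power)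
    finally show ?thesis
      by simp
  qed
  then show "k j = l j"
    using eq by metis
qed

text \<open>
  On the points \<open>z\<^sub>i = p\<^sub>i\<^sup>-\<^sup>s\<close> with distinct primes \<open>p\<^sub>i\<close> the power series becomes a Dirichlet
  series whose frequencies \<open>\<Prod>p\<^sub>i^k\<^sub>i\<close> are pairwise distinct by unique factorization. Its leading
  term dominates the rest as \<open>s\<close> grows, so it must vanish.
\<close>

lemma power_series_eq_0:
  fixes d :: "('m::finite \<Rightarrow> nat) \<Rightarrow> complex"
  assumes sum0: "\<And>z. z \<in> ball 0 1 \<Longrightarrow> ((\<lambda>k. monomial k z * d k) has_sum 0) UNIV"
  shows "d k = 0"
proof (rule ccontr)
  assume "d k \<noteq> 0"
  obtain p :: "'m \<Rightarrow> nat" where p: "inj p" "\<And>i. prime (p i)"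
    using exists_prime_labelling by blast
  define n where "n = (\<lambda>k. \<Prod>i\<in>UNIV. p i ^ k i)"
  have inj_n: "inj n"
    unfolding n_def by (rule prod_prime_powers_inj[OF p])
  have n_pos: "n k > 0" for k
    unfolding n_def using p by (auto intro!: prod_pos simp: prime_gt_0_nat)
  obtain k0 where k0: "d k0 \<noteq> 0" "\<And>k. d k \<noteq> 0 \<Longrightarrow> n k0 \<le> n k"
    using ex_has_least_nat[of "\<lambda>k. d k \<noteq> 0" k n] \<open>d k \<noteq> 0\<close> by blast
  have k0': "Suc (n k0) \<le> n k" if "d k \<noteq> 0" "k \<noteq> k0" for k
    using k0(2)[OF that(1)] inj_n that(2) by (metis inj_eq le_neq_implies_less Suc_leI)
  define z :: "nat \<Rightarrow> complex ^ 'm" where "z = (\<lambda>s. \<chi> i. complex_of_real ((1 / real (p i)) ^ s))"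
  \<comment> \<open>From this exponent on, the points lie in the ball, because \<open>p\<^sub>i \<ge> 2\<close> and \<open>m < 2\<^sup>m\<close>.\<close>
  let ?s0 = "CARD('m)"
  have z_ball: "z s \<in> ball 0 1" if "s \<ge> ?s0" for s
  proof -
    have "norm (z s) \<le> (\<Sum>i\<in>UNIV. norm (z s $ i))"
      unfolding norm_vec_def by (rule L2_set_le_sum) simp
    also have "\<dots> \<le> (\<Sum>i\<in>(UNIV :: 'm set). (1 / 2) ^ ?s0)"
    proof (rule sum_mono)
      fix i
      have "(1 / real (p i)) ^ s \<le> (1 / real (p i)) ^ ?s0"
        using that p(2)[of i] by (intro power_decreasing) (auto dest: prime_ge_1_nat)
      also have "\<dots> \<le> (1 / 2) ^ ?s0"
        using prime_ge_2_nat[OF p(2), of i] by (intro power_mono) (auto simp: frac_le)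
      finally show "norm (z s $ i) \<le> (1 / 2) ^ ?s0"
        by (simp add: z_def norm_power norm_divide)
    qed
    also have "\<dots> = real ?s0 / 2 ^ ?s0"
      by (simp add: power_one_over)
    also have "\<dots> < 1"
      using of_nat_less_two_power[of ?s0, where 'a = real] by simp
    finally show ?thesis
      by simp
  qed
  have mono: "monomial k (z s) = complex_of_real ((1 / real (n k)) ^ s)" for k s
    by (simp add: monomial_def z_def n_def power_divide prod_dividef prod_power_distrib
        flip: power_mult) (simp add: mult.commute)
  define g where "g = (\<lambda>k. norm (monomial k (z ?s0) * d k))"
  have g_sum: "g summable_on UNIV"
    using has_sum_imp_summable[OF sum0[OF z_ball[OF order_refl]]]
    unfolding g_def summable_on_iff_abs_summable_on_complex[symmetric] .
  define M where "M = infsum g (UNIV - {k0})"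
  have g_sum': "(g has_sum M) (UNIV - {k0})"
    unfolding M_def by (intro has_sum_infsum summable_on_subset_banach[OF g_sum]) auto
  \<comment> \<open>The frequencies are integers, so every other one exceeds the least by at least \<open>1\<close>.\<close>
  let ?q = "real (n k0) / real (Suc (n k0))"
  have bound: "norm (d k0) * (1 / real (n k0)) ^ ?s0 \<le> ?q ^ t * M" for t
  proof -
    have tot: "((\<lambda>k. monomial k (z (?s0 + t)) * d k) has_sum 0) UNIV"
      by (intro sum0 z_ball) simp
    have "((\<lambda>k. monomial k (z (?s0 + t)) * d k) has_sum
        (0 - monomial k0 (z (?s0 + t)) * d k0)) (UNIV - {k0})"
      by (rule has_sum_Diff[OF tot]) (auto intro: has_sum_finiteI)
    moreover have "((\<lambda>k. (1 / real (Suc (n k0))) ^ t * g k) has_sum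
        (1 / real (Suc (n k0))) ^ t * M) (UNIV - {k0})"
      by (rule has_sum_cmult_right[OF g_sum'])
    ultimately have "norm (0 - monomial k0 (z (?s0 + t)) * d k0) \<le> (1 / real (Suc (n k0))) ^ t * M"
    proof (rule norm_infsum_le)
      fix k assume k: "k \<in> UNIV - {k0}"
      show "norm (monomial k (z (?s0 + t)) * d k) \<le> (1 / real (Suc (n k0))) ^ t * g k"
      proof (cases "d k = 0")
        case False
        have "(1 / real (n k)) ^ t \<le> (1 / real (Suc (n k0))) ^ t"
          using k0'[OF False] k by (intro power_mono frac_le) auto
        then have "(1 / real (n k)) ^ t * ((1 / real (n k)) ^ ?s0 * norm (d k))
            \<le> (1 / real (Suc (n k0))) ^ t * ((1 / real (n k)) ^ ?s0 * norm (d k))"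
          by (intro mult_right_mono) auto
        then show ?thesis
          by (simp add: g_def mono norm_mult norm_power norm_divide power_add mult_ac)
      qed (simp add: g_def)
    qed
    then have "(1 / real (n k0)) ^ t * (norm (d k0) * (1 / real (n k0)) ^ ?s0)
        \<le> (1 / real (Suc (n k0))) ^ t * M"
      by (simp add: mono norm_mult norm_power norm_divide power_add mult_ac)
    then have "real (n k0) ^ t * ((1 / real (n k0)) ^ t * (norm (d k0) * (1 / real (n k0)) ^ ?s0))
        \<le> real (n k0) ^ t * ((1 / real (Suc (n k0))) ^ t * M)"
      by (intro mult_left_mono) auto
    moreover have "real (n k0) ^ t * (1 / real (n k0)) ^ t = 1"
      using n_pos[of k0] by (simp flip: power_mult_distrib)
    moreover have "real (n k0) ^ t * (1 / real (Suc (n k0))) ^ t = ?q ^ t"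
      by (simp flip: power_mult_distrib)
    ultimately show ?thesis
      by (simp only: mult.assoc[symmetric] mult_1_left)
  qed
  have "(\<lambda>t. ?q ^ t * M) \<longlonglongrightarrow> 0 * M"
    by (intro tendsto_mult_right LIMSEQ_power_zero) (auto simp: divide_simps)
  then have "norm (d k0) * (1 / real (n k0)) ^ ?s0 \<le> 0"
    using bound by (intro Lim_bounded2[of "\<lambda>t. ?q ^ t * M" 0 0]) auto
  moreover have "norm (d k0) * (1 / real (n k0)) ^ ?s0 > 0"
    using k0(1) n_pos[of k0] by simp
  ultimately show False
    by linarith
qed

lemma has_sum_diff:
  fixes f g :: "'a \<Rightarrow> 'b::topological_ab_group_add"
  assumes "(f has_sum s) A" "(g has_sum t) A"
  shows "((\<lambda>x. f x - g x) has_sum (s - t)) A"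
proof -
  have "((\<lambda>x. - g x) has_sum - t) A"
    using assms(2) by (simp add: has_sum_uminus)
  from has_sum_add[OF assms(1) this] show ?thesis
    by simp
qed

text \<open>Pairing the difference with one of its own coefficients reduces to scalar series.\<close>

lemma da_expansion_unique:
  assumes "da_expansion a f" "da_expansion b f"
  shows "a = b"
proof (rule ext)
  fix l
  let ?y = "a l - b l"
  have "cinner (a k - b k) ?y = 0" for k
  proof (rule power_series_eq_0[where d = "\<lambda>k. cinner (a k - b k) ?y"])
    fix z :: "complex ^ 'a" assume z: "z \<in> ball 0 1"
    have "((\<lambda>k. cinner (monomial k z *\<^sub>C c k) ?y) has_sum cinner (f z) ?y) UNIV"
      if "da_expansion c f" for c
      using that z
        has_sum_bounded_linear[OF bounded_linear_cinner[of ?y], of "\<lambda>k. monomial k z *\<^sub>C c k" UNIV "f z"]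
      by (simp add: da_expansion_def)
    from has_sum_diff[OF this[OF assms(1)] this[OF assms(2)]] show "((\<lambda>k. monomial k z * cinner (a k - b k) ?y) has_sum 0) UNIV"
      by (simp add: cinner_scaleC_left cinner_diff_left right_diff_distrib)
  qed
  from this[of l] show "a l = b l"
    by simp
qed

lemma da_coeff_eq: "da_expansion a f \<Longrightarrow> da_coeff f = a"
  unfolding da_coeff_def by (rule the_equality) (auto intro: da_expansion_unique)

lemma da_expansion_fun_unique:
  assumes "da_expansion a f" "da_expansion a g"
  shows "f = g"
proof (rule ext)
  fix z
  show "f z = g z"
    using assms has_sum_unique[of "\<lambda>k. monomial k z *\<^sub>C a k" UNIV "f z" "g z"]
    by (cases "z \<in> ball 0 1") (auto simp: da_expansion_def)
qed


section \<open>The Drury--Arveson module\<close>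

lemma da_weight_pos: "da_weight k > 0"
  by (auto simp: da_weight_def intro!: divide_pos_pos prod_pos)

lemma da_weight_zero [simp]: "da_weight (\<lambda>_. 0) = 1"
  by (simp add: da_weight_def)

lemma monomial_zero [simp]: "monomial (\<lambda>_. 0) z = 1"
  by (simp add: monomial_def)

lemma da_expansion_add:
  assumes "da_expansion a f" "da_expansion b g"
  shows "da_expansion (\<lambda>k. a k + b k) (\<lambda>z. f z + g z)"
proof -
  have "(\<lambda>k. (norm (a k + b k))\<^sup>2 * da_weight k) summable_on UNIV"
  proof (rule summable_on_comparison_test)
    show "(\<lambda>k. 2 * ((norm (a k))\<^sup>2 * da_weight k) + 2 * ((norm (b k))\<^sup>2 * da_weight k)) summable_on UNIV"
      using assms by (intro summable_on_add summable_on_cmult_right) (auto simp: da_expansion_def)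
    fix k
    have "(norm (a k + b k))\<^sup>2 \<le> 2 * (norm (a k))\<^sup>2 + 2 * (norm (b k))\<^sup>2"
      using inner_ge_zero[of "a k - b k"]
      by (simp add: power2_norm_eq_inner inner_add_left inner_add_right inner_diff_left
          inner_diff_right inner_commute)
    then show "(norm (a k + b k))\<^sup>2 * da_weight k
        \<le> 2 * ((norm (a k))\<^sup>2 * da_weight k) + 2 * ((norm (b k))\<^sup>2 * da_weight k)"
      using mult_right_mono[OF _ less_imp_le[OF da_weight_pos[of k]]] by (fastforce simp: algebra_simps)
    show "0 \<le> (norm (a k + b k))\<^sup>2 * da_weight k"
      using da_weight_pos[of k] by simp
  qed
  then show ?thesis
    using assms by (auto simp: da_expansion_def scaleC_add_right intro!: has_sum_add)
qed

lemma da_expansion_compose: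
  assumes A: "bounded_clinear A" and a: "da_expansion a f"
  shows "da_expansion (\<lambda>k. A (a k)) (\<lambda>z. A (f z))"
proof -
  note A' = bounded_clinearD[OF A]
  obtain K where K: "\<And>x. norm (A x) \<le> norm x * K"
    using bounded_linear.bounded[OF A'(3)] by blast
  have "(\<lambda>k. (norm (A (a k)))\<^sup>2 * da_weight k) summable_on UNIV"
  proof (rule summable_on_comparison_test)
    show "(\<lambda>k. K\<^sup>2 * ((norm (a k))\<^sup>2 * da_weight k)) summable_on UNIV"
      using a by (intro summable_on_cmult_right) (auto simp: da_expansion_def)
    fix k
    have "(norm (A (a k)))\<^sup>2 \<le> (norm (a k) * K)\<^sup>2"
      using K by (intro power_mono) auto
    then show "(norm (A (a k)))\<^sup>2 * da_weight k \<le> K\<^sup>2 * ((norm (a k))\<^sup>2 * da_weight k)"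
      using mult_right_mono[OF _ less_imp_le[OF da_weight_pos[of k]]]
      by (fastforce simp: power_mult_distrib mult_ac)
    show "0 \<le> (norm (A (a k)))\<^sup>2 * da_weight k"
      using da_weight_pos[of k] by simp
  qed
  moreover have "((\<lambda>k. monomial k z *\<^sub>C A (a k)) has_sum A (f z)) UNIV" if "z \<in> ball 0 1" for z
    using has_sum_bounded_linear[OF A'(3), of "\<lambda>k. monomial k z *\<^sub>C a k" UNIV "f z"] a that
    by (auto simp: da_expansion_def A'(2))
  ultimately show ?thesis
    using a A'(4) by (auto simp: da_expansion_def)
qed

lemma bounded_clinear_scaleC: "bounded_clinear (\<lambda>x. c *\<^sub>C x)"
  by (rule bounded_clinearI[where K = "cmod c"])
    (auto simp: scaleC_add_right scaleC_scaleC norm_scaleC mult.commute)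

lemma da_expansion_scaleC:
  "da_expansion a f \<Longrightarrow> da_expansion (\<lambda>k. c *\<^sub>C a k) (\<lambda>z. c *\<^sub>C f z)"
  by (rule da_expansion_compose[OF bounded_clinear_scaleC])

lemma da_expansion_diff:
  assumes "da_expansion a f" "da_expansion b g"
  shows "da_expansion (\<lambda>k. a k - b k) (\<lambda>z. f z - g z)"
  using da_expansion_add[OF assms(1) da_expansion_scaleC[OF assms(2), of "-1"]]
  by (simp add: scaleC_minus_one)

definition monomial_fun :: "('m::finite \<Rightarrow> nat) \<Rightarrow> 'e::complex_hilbert \<Rightarrow> complex ^ 'm \<Rightarrow> 'e"
  where "monomial_fun k x = (\<lambda>z. if z \<in> ball 0 1 then monomial k z *\<^sub>C x else 0)"

lemma da_expansion_monomial_fun: "da_expansion (\<lambda>l. if l = k then x else 0) (monomial_fun k x)"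
proof -
  have "(\<lambda>l. (norm (if l = k then x else 0))\<^sup>2 * da_weight l) summable_on UNIV"
    by (rule has_sum_imp_summable, rule has_sum_finite_neutralI[of "{k}"]) auto
  moreover have "((\<lambda>l. monomial l z *\<^sub>C (if l = k then x else 0)) has_sum monomial k z *\<^sub>C x) UNIV" for z
    by (rule has_sum_finite_neutralI[of "{k}"]) auto
  ultimately show ?thesis
    by (auto simp: da_expansion_def monomial_fun_def)
qed

lemma da_expansion_zero: "da_expansion (\<lambda>_. 0) (\<lambda>_. 0)"
  by (auto simp: da_expansion_def)

definition up :: "'m \<Rightarrow> ('m \<Rightarrow> nat) \<Rightarrow> 'm \<Rightarrow> nat"
  where "up i k = k(i := Suc (k i))"

text \<open>If \<open>a\<close> are the coefficients of \<open>f\<close>, then these are the coefficients of \<open>z\<^sub>i f\<close>.\<close>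

definition shift :: "'m \<Rightarrow> (('m \<Rightarrow> nat) \<Rightarrow> 'e::zero) \<Rightarrow> ('m \<Rightarrow> nat) \<Rightarrow> 'e"
  where "shift i a k = (if k i = 0 then 0 else a (k(i := k i - 1)))"

lemma inj_up: "inj (up i)"
proof (rule injI)
  fix k l assume eq: "up i k = up i l"
  show "k = l"
  proof
    fix j show "k j = l j"
      using fun_cong[OF eq, of j] by (cases "j = i") (auto simp: up_def)
  qed
qed

lemma shift_up [simp]: "shift i a (up i k) = a k"
  by (simp add: shift_def up_def)

lemma shift_notin_range:
  assumes "k \<notin> range (up i)"
  shows "shift i a k = 0"
proof (rule ccontr)
  assume "shift i a k \<noteq> 0"
  then have "k i \<noteq> 0"
    by (auto simp: shift_def split: if_splits)
  then have "k = up i (k(i := k i - 1))"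
    by (auto simp: up_def)
  with assms show False
    by auto
qed

lemma monomial_up: "monomial (up i k) z = z $ i * monomial k z"
  by (simp add: monomial_def up_def prod.remove[of UNIV i] mult.assoc)

lemma sum_up: "(\<Sum>j\<in>UNIV. up i k j) = Suc (\<Sum>j\<in>UNIV. k (j::'m::finite))"
  by (simp add: up_def sum.remove[of UNIV i])

lemma da_weight_up:
  "da_weight (up i k) = da_weight k * (real (Suc (k i)) / real (Suc (\<Sum>j\<in>UNIV. k j)))"
proof -
  have "(\<Prod>j\<in>UNIV. fact (up i k j)) = real (Suc (k i)) * (\<Prod>j\<in>UNIV. fact (k j))"
    by (simp add: up_def prod.remove[of UNIV i])
  then show ?thesis
    unfolding da_weight_def sum_up by (simp add: field_simps del: of_nat_Suc)
qed

lemma has_sum_up_iff: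
  assumes "\<And>k. k \<notin> range (up i) \<Longrightarrow> g k = 0"
  shows "(g has_sum s) UNIV \<longleftrightarrow> ((\<lambda>k. g (up i k)) has_sum s) UNIV"
proof -
  have "(g has_sum s) UNIV \<longleftrightarrow> (g has_sum s) (range (up i))"
    using assms by (intro has_sum_cong_neutral) auto
  also have "\<dots> \<longleftrightarrow> ((\<lambda>k. g (up i k)) has_sum s) UNIV"
    using has_sum_reindex[OF inj_up[of i], of g s] by (simp add: o_def)
  finally show ?thesis .
qed

text \<open>
  Since \<open>da_weight (k + e\<^sub>i) = da_weight k * (k\<^sub>i + 1) / (\<bar>k\<bar> + 1)\<close>, multiplication by a coordinate
  function is a weighted shift which is strictly contractive except along powers of \<open>z\<^sub>i\<close>.
\<close>

lemma coordinate_factor_le_1: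
  "real (Suc (k i)) / real (Suc (\<Sum>j\<in>UNIV. k (j::'m::finite))) \<le> 1"
proof -
  have "k i \<le> (\<Sum>j\<in>UNIV. k j)"
    by (rule member_le_sum) auto
  then show ?thesis
    by (simp add: divide_le_eq_1 del: of_nat_sum)
qed

lemma da_expansion_shift:
  assumes a: "da_expansion a f"
  shows "da_expansion (shift i a) (\<lambda>z. (z $ i) *\<^sub>C f z)"
proof -
  have "(\<lambda>k. (norm (a k))\<^sup>2 * da_weight (up i k)) summable_on UNIV"
  proof (rule summable_on_comparison_test)
    show "(\<lambda>k. (norm (a k))\<^sup>2 * da_weight k) summable_on UNIV"
      using a by (simp add: da_expansion_def)
    fix k
    have "da_weight (up i k) \<le> da_weight k * 1"
      unfolding da_weight_up using coordinate_factor_le_1 less_imp_le[OF da_weight_pos]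
      by (rule mult_left_mono)
    then show "(norm (a k))\<^sup>2 * da_weight (up i k) \<le> (norm (a k))\<^sup>2 * da_weight k"
      by (intro mult_left_mono) auto
    show "0 \<le> (norm (a k))\<^sup>2 * da_weight (up i k)"
      using da_weight_pos[of "up i k"] by simp
  qed
  then obtain s where "((\<lambda>k. (norm (a k))\<^sup>2 * da_weight (up i k)) has_sum s) UNIV"
    by (auto simp: summable_on_def)
  then have "((\<lambda>k. (norm (shift i a k))\<^sup>2 * da_weight k) has_sum s) UNIV"
    by (subst has_sum_up_iff[of i]) (auto simp: shift_notin_range)
  moreover have "((\<lambda>k. monomial k z *\<^sub>C shift i a k) has_sum (z $ i) *\<^sub>C f z) UNIV"
    if "z \<in> ball 0 1" for z
  proof -
    have "((\<lambda>k. (z $ i) *\<^sub>C (monomial k z *\<^sub>C a k)) has_sum (z $ i) *\<^sub>C f z) UNIV"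
      by (rule has_sum_bounded_linear[OF bounded_linear_scaleC]) (use a that in \<open>auto simp: da_expansion_def\<close>)
    then show ?thesis
      by (subst has_sum_up_iff[of i]) (auto simp: shift_notin_range monomial_up scaleC_scaleC)
  qed
  ultimately show ?thesis
    using a by (auto simp: da_expansion_def dest: has_sum_imp_summable)
qed

lemma DA_simps [simp]:
  "mzero (DA E) = (\<lambda>z. 0)"
  "mplus (DA E) = (\<lambda>f g z. f z + g z)"
  "mscale (DA E) = (\<lambda>c f z. c *\<^sub>C f z)"
  "mact (DA E) = (\<lambda>i f z. (z $ i) *\<^sub>C f z)"
  by (simp_all add: DA_def)

lemma mem_DA_iff: "f \<in> mcarrier (DA E) \<longleftrightarrow> (\<exists>a. (\<forall>k. a k \<in> E) \<and> da_expansion a f)"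
  by (simp add: DA_def)

lemma mem_DAI: "da_expansion a f \<Longrightarrow> (\<And>k. a k \<in> E) \<Longrightarrow> f \<in> mcarrier (DA E)"
  by (auto simp: mem_DA_iff)

lemma mem_DAD:
  assumes "f \<in> mcarrier (DA E)"
  shows "da_expansion (da_coeff f) f" "da_coeff f k \<in> E"
  using assms da_coeff_eq by (auto simp: mem_DA_iff)

lemma minner_DA:
  "minner (DA E) f g =
    (\<Sum>\<^sub>\<infinity>k. complex_of_real (da_weight k) * cinner (da_coeff f k) (da_coeff g k))"
  by (simp add: DA_def)

lemma minner_DA_eq_0:
  assumes "\<And>k. cinner (da_coeff f k) (da_coeff g k) = 0"
  shows "minner (DA E) f g = 0"
  using assms by (simp add: minner_DA)

lemma has_sum_mnorm_DA:
  assumes a: "da_expansion a f"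
  shows "((\<lambda>k. (norm (a k))\<^sup>2 * da_weight k) has_sum (mnorm (DA E) f)\<^sup>2) UNIV"
proof -
  obtain s where s: "((\<lambda>k. (norm (a k))\<^sup>2 * da_weight k) has_sum s) UNIV"
    using a by (auto simp: da_expansion_def summable_on_def)
  then have "((\<lambda>k. complex_of_real ((norm (a k))\<^sup>2 * da_weight k)) has_sum complex_of_real s) UNIV"
    by (rule has_sum_of_real)
  then have "minner (DA E) f f = complex_of_real s"
    unfolding minner_DA da_coeff_eq[OF a] by (intro infsumI) (simp add: cinner_self mult.commute)
  moreover have "s \<ge> 0"
    using s by (rule has_sum_nonneg) (simp add: less_imp_le[OF da_weight_pos])
  ultimately show ?thesis
    using s by (simp add: mnorm_def)
qed

lemma mnorm_DA_nonneg: "f \<in> mcarrier (DA E) \<Longrightarrow> mnorm (DA E') f \<ge> 0"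
proof -
  assume "f \<in> mcarrier (DA E)"
  from has_sum_mnorm_DA[OF mem_DAD(1)[OF this], of E']
  have s: "((\<lambda>k. (norm (da_coeff f k))\<^sup>2 * da_weight k) has_sum (mnorm (DA E') f)\<^sup>2) UNIV" .
  have "infsum (\<lambda>k. complex_of_real (da_weight k) * cinner (da_coeff f k) (da_coeff f k)) UNIV
     = complex_of_real ((mnorm (DA E') f)\<^sup>2)"
    using has_sum_of_real[OF s] by (intro infsumI) (simp add: cinner_self mult.commute)
  then have "Re (minner (DA E') f f) \<ge> 0"
    unfolding minner_DA by simp
  then show ?thesis
    by (simp add: mnorm_def)
qed

lemma has_sum_mnorm_act:
  assumes a: "da_expansion a f"
  shows "((\<lambda>k. (norm (a k))\<^sup>2 * da_weight (up i k)) has_sum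
    (mnorm (DA E) (\<lambda>z. (z $ i) *\<^sub>C f z))\<^sup>2) UNIV"
  using has_sum_mnorm_DA[OF da_expansion_shift[OF a, of i], of E]
  by (subst (asm) has_sum_up_iff[of i]) (auto simp: shift_notin_range)

text \<open>
  If all coordinates preserve the norm of \<open>f\<close>, then \<open>\<bar>k\<bar> = k\<^sub>i\<close> for every exponent \<open>k\<close> of \<open>f\<close> and
  every \<open>i\<close>. With at least two coordinates only the constant term survives.
\<close>

lemma constant_if_coordinates_preserve_norm:
  fixes f :: "complex ^ 'm::finite \<Rightarrow> 'e::complex_hilbert"
  assumes m: "CARD('m) > 1" and a: "da_expansion a f"
    and iso: "\<And>i. mnorm (DA E) (\<lambda>z. (z $ i) *\<^sub>C f z) = mnorm (DA E) f"
    and k: "k \<noteq> (\<lambda>_. 0)"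
  shows "a k = 0"
proof (rule ccontr)
  assume ak: "a k \<noteq> 0"
  have eq: "(\<Sum>j\<in>UNIV. k j) = k i" for i
  proof -
    let ?r = "\<lambda>k. real (Suc (k i)) / real (Suc (\<Sum>j\<in>UNIV. k j))"
    have "((\<lambda>k. (norm (a k))\<^sup>2 * da_weight k - (norm (a k))\<^sup>2 * da_weight (up i k)) has_sum
       (mnorm (DA E) f)\<^sup>2 - (mnorm (DA E) f)\<^sup>2) UNIV"
      using has_sum_mnorm_DA[OF a, of E] has_sum_mnorm_act[OF a, of i E] unfolding iso
      by (rule has_sum_diff)
    then have "((\<lambda>k. (norm (a k))\<^sup>2 * (da_weight k * (1 - ?r k))) has_sum 0) UNIV"
      by (simp only: da_weight_up diff_self right_diff_distrib mult_1_right mult.assoc)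
    then have "(norm (a k))\<^sup>2 * (da_weight k * (1 - ?r k)) = 0"
    proof (rule nonneg_has_sum_le_0D)
      show "0 \<le> (norm (a k))\<^sup>2 * (da_weight k * (1 - ?r k))" for k
        using coordinate_factor_le_1[of k i] less_imp_le[OF da_weight_pos[of k]]
        by (intro mult_nonneg_nonneg) auto
    qed auto
    then have "?r k = 1"
      using ak da_weight_pos[of k] by simp
    then show ?thesis
      by (simp add: divide_eq_1_iff del: of_nat_sum)
  qed
  obtain i j :: 'm where ij: "i \<noteq> j"
    using m card_le_Suc0_iff_eq[of "UNIV :: 'm set"] by auto
  have "k i + k j = (\<Sum>l\<in>{i, j}. k l)"
    using ij by simp
  also have "\<dots> \<le> (\<Sum>l\<in>UNIV. k l)"
    by (rule sum_mono2) auto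
  finally have "(\<Sum>l\<in>UNIV. k l) = 0"
    using eq[of i] eq[of j] by linarith
  then show False
    using k by auto
qed


section \<open>Function spaces with values in a subspace\<close>

text \<open>
  The orthogonal projection onto \<open>E\<close> fixes the coefficients and therefore the function, so that
  the values lie in \<open>E\<close> as well.
\<close>

lemma mem_DA_value:
  assumes E: "hilbert_subspace E" and f: "f \<in> mcarrier (DA E)"
  shows "f z \<in> E"
proof -
  have "da_expansion (\<lambda>k. oproj E (da_coeff f k)) (\<lambda>z. oproj E (f z))"
    by (rule da_expansion_compose[OF bounded_clinear_oproj[OF E] mem_DAD(1)[OF f]])
  then have "da_expansion (da_coeff f) (\<lambda>z. oproj E (f z))"
    using mem_DAD(2)[OF f] by (simp add: oproj_ident[OF E])
  then have "(\<lambda>z. oproj E (f z)) = f"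
    using mem_DAD(1)[OF f] by (rule da_expansion_fun_unique)
  then show ?thesis
    using oproj_in[OF E] by metis
qed

lemma mem_DA_off_ball: "f \<in> mcarrier (DA E) \<Longrightarrow> z \<notin> ball 0 1 \<Longrightarrow> f z = 0"
  by (auto simp: mem_DA_iff da_expansion_def)

lemma mem_DA_subset: "f \<in> mcarrier (DA E) \<Longrightarrow> E \<subseteq> E' \<Longrightarrow> f \<in> mcarrier (DA E')"
  by (auto simp: mem_DA_iff)

lemma mem_DA_compose:
  assumes "bounded_clinear A" "f \<in> mcarrier (DA E)" "\<And>x. x \<in> E \<Longrightarrow> A x \<in> E'"
  shows "(\<lambda>z. A (f z)) \<in> mcarrier (DA E')"
  using mem_DAI[OF da_expansion_compose[OF assms(1) mem_DAD(1)[OF assms(2)]]] assms(3) mem_DAD(2)[OF assms(2)]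
  by auto

lemma mem_DA_zero: "0 \<in> E \<Longrightarrow> (\<lambda>_. 0) \<in> mcarrier (DA E)"
  by (rule mem_DAI[OF da_expansion_zero])

lemma mem_DA_monomial_fun: "0 \<in> E \<Longrightarrow> x \<in> E \<Longrightarrow> monomial_fun k x \<in> mcarrier (DA E)"
  by (rule mem_DAI[OF da_expansion_monomial_fun]) auto

lemma mem_DA_ops:
  assumes E: "hilbert_subspace E" and f: "f \<in> mcarrier (DA E)"
  shows mem_DA_add: "g \<in> mcarrier (DA E) \<Longrightarrow> (\<lambda>z. f z + g z) \<in> mcarrier (DA E)"
    and mem_DA_diff: "g \<in> mcarrier (DA E) \<Longrightarrow> (\<lambda>z. f z - g z) \<in> mcarrier (DA E)"
    and mem_DA_scale: "(\<lambda>z. c *\<^sub>C f z) \<in> mcarrier (DA E)"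
    and mem_DA_act: "(\<lambda>z. (z $ i) *\<^sub>C f z) \<in> mcarrier (DA E)"
proof -
  note E' = hilbert_subspaceD[OF E] and f' = mem_DAD[OF f]
  show "(\<lambda>z. f z + g z) \<in> mcarrier (DA E)" "(\<lambda>z. f z - g z) \<in> mcarrier (DA E)"
    if g: "g \<in> mcarrier (DA E)"
    using mem_DAI[OF da_expansion_add[OF f'(1) mem_DAD(1)[OF g]]]
      mem_DAI[OF da_expansion_diff[OF f'(1) mem_DAD(1)[OF g]]] f'(2) mem_DAD(2)[OF g] E'(2,5)
    by auto
  show "(\<lambda>z. c *\<^sub>C f z) \<in> mcarrier (DA E)"
    using mem_DAI[OF da_expansion_scaleC[OF f'(1)]] f'(2) E'(3) by auto
  show "(\<lambda>z. (z $ i) *\<^sub>C f z) \<in> mcarrier (DA E)"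
    by (rule mem_DAI[OF da_expansion_shift[OF f'(1)]]) (auto simp: shift_def f'(2) E'(1))
qed

lemma mem_DA_singleton_zero: "f \<in> mcarrier (DA {0}) \<longleftrightarrow> f = (\<lambda>_. 0)"
  using mem_DA_value[OF hilbert_subspace_zero] mem_DA_zero[of "{0}"] by auto

lemma mnorm_constant:
  fixes i :: "'m::finite" and x :: "'e::complex_hilbert"
  shows "mnorm (DA E) (monomial_fun (\<lambda>_::'m. 0) x) = norm x"
    and "mnorm (DA E) (\<lambda>z. (z $ i) *\<^sub>C monomial_fun (\<lambda>_. 0) x z) = norm x"
proof -
  let ?f = "monomial_fun (\<lambda>_. 0) x :: complex ^ 'm \<Rightarrow> 'e"
  note ex = da_expansion_monomial_fun[of "\<lambda>_. 0" x]
  have f: "?f \<in> mcarrier (DA UNIV)"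
    by (rule mem_DA_monomial_fun) auto
  have "((\<lambda>k. (norm (if k = (\<lambda>_. 0) then x else 0))\<^sup>2 * da_weight (k :: 'm \<Rightarrow> nat)) has_sum (norm x)\<^sup>2) UNIV"
    by (rule has_sum_finite_neutralI[of "{\<lambda>_. 0}"]) auto
  then have "(mnorm (DA E) ?f)\<^sup>2 = (norm x)\<^sup>2"
    by (rule has_sum_unique[OF has_sum_mnorm_DA[OF ex]])
  then show "mnorm (DA E) ?f = norm x"
    using mnorm_DA_nonneg[OF f] by (simp add: power2_eq_iff_nonneg)
  have "((\<lambda>k. (norm (if k = (\<lambda>_. 0) then x else 0))\<^sup>2 * da_weight (up i k)) has_sum (norm x)\<^sup>2) UNIV"
    by (rule has_sum_finite_neutralI[of "{\<lambda>_. 0}"]) (auto simp: da_weight_up)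
  then have "(mnorm (DA E) (\<lambda>z. (z $ i) *\<^sub>C ?f z))\<^sup>2 = (norm x)\<^sup>2"
    by (rule has_sum_unique[OF has_sum_mnorm_act[OF ex]])
  moreover have "(\<lambda>z. (z $ i) *\<^sub>C ?f z) \<in> mcarrier (DA UNIV)"
    by (rule mem_DA_act[OF _ f]) (auto simp: hilbert_subspace_def)
  ultimately show "mnorm (DA E) (\<lambda>z. (z $ i) *\<^sub>C ?f z) = norm x"
    by (intro power2_eq_imp_eq[OF _ mnorm_DA_nonneg]) auto
qed

text \<open>
  A right inverse of \<open>A\<close>, made total by the projection onto \<open>A ` E\<close>, is bounded; so
  composition with it lifts every function with values in \<open>A ` E\<close>.
\<close>

lemma image_DA_partial_isometry:
  assumes G: "hilbert_subspace G" and E: "hilbert_subspace E" and GE: "G \<subseteq> E"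
    and A: "bounded_clinear A"
    and ker: "\<And>x. x \<in> G \<Longrightarrow> A x = 0"
    and iso: "\<And>x. x \<in> ocompl E G \<Longrightarrow> norm (A x) = norm x"
  shows "(\<lambda>f z. A (f z)) ` mcarrier (DA E) = mcarrier (DA (A ` E))"
proof
  show "(\<lambda>f z. A (f z)) ` mcarrier (DA E) \<subseteq> mcarrier (DA (A ` E))"
    by (auto intro!: mem_DA_compose[OF A])
  let ?F = "ocompl E G"
  note A' = bounded_clinearD[OF A]
  note F = hilbert_subspaceD[OF hilbert_subspace_ocompl[OF E, of G]]
  have im: "A ` E = A ` ?F" "hilbert_subspace (A ` E)"
    using image_partial_isometry[OF G E GE A] ker iso by blast+
  have inj: "x = y" if "x \<in> ?F" "y \<in> ?F" "A x = A y" for x y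
    using iso[OF F(5)[OF that(1,2)]] that(3) A'(5) by simp
  define B where "B = (\<lambda>x. inv_into ?F A (oproj (A ` E) x))"
  have "oproj (A ` E) x \<in> A ` ?F" for x
    by (subst im(1)[symmetric]) (rule oproj_in[OF im(2)])
  then have B: "B x \<in> ?F" "A (B x) = oproj (A ` E) x" for x
    unfolding B_def by (rule inv_into_into, rule f_inv_into_f)
  note P = bounded_clinear_oproj[OF im(2)]
  obtain K where K: "\<And>x. norm (oproj (A ` E) x) \<le> norm x * K"
    using bounded_linear.bounded[OF bounded_clinearD(3)[OF P]] by blast
  have "bounded_clinear B"
  proof (rule bounded_clinearI)
    show "B (x + y) = B x + B y" for x y
      by (rule inj) (use B F in \<open>auto simp: A' bounded_clinearD[OF P]\<close>)
    show "B (c *\<^sub>C x) = c *\<^sub>C B x" for c x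
      by (rule inj) (use B F in \<open>auto simp: A' bounded_clinearD[OF P]\<close>)
    show "norm (B x) \<le> norm x * K" for x
      using iso[OF B(1)] B(2) K by metis
  qed
  show "mcarrier (DA (A ` E)) \<subseteq> (\<lambda>f z. A (f z)) ` mcarrier (DA E)"
  proof
    fix h assume h: "h \<in> mcarrier (DA (A ` E))"
    have "A (B (h z)) = h z" for z
      using B(2) oproj_ident[OF im(2) mem_DA_value[OF im(2) h]] by simp
    moreover have "(\<lambda>z. B (h z)) \<in> mcarrier (DA E)"
      by (rule mem_DA_compose[OF \<open>bounded_clinear B\<close> h]) (use B in \<open>auto simp: ocompl_def\<close>)
    ultimately show "h \<in> (\<lambda>f z. A (f z)) ` mcarrier (DA E)"
      by (intro image_eqI[of _ _ "\<lambda>z. B (h z)"]) auto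
  qed
qed


section \<open>Rigidity of inner multipliers\<close>

text \<open>
  On the orthogonal complement of its kernel the multiplication operator is isometric. Hence it
  sends a constant to a function whose norm is preserved by all coordinates, that is, to a
  constant. Constants from the kernel are sent to zero, and every constant in
  \<open>E\<close> is a sum of the two kinds.
\<close>

lemma inner_multiplier_constant:
  fixes \<phi> :: "complex ^ 'm::finite \<Rightarrow> 'a::complex_hilbert \<Rightarrow>\<^sub>L 'b::complex_hilbert"
  assumes m: "CARD('m) > 1"
    and E: "hilbert_subspace E" and inner: "inner_multiplier E E' \<phi>"
    and G: "hilbert_subspace G" and GE: "G \<subseteq> E"
    and ker: "mkernel (DA E) (DA E') (mult_op \<phi>) = mcarrier (DA G)"
  shows "bounded_clinear (blinfun_apply (\<phi> 0))"
    and "\<And>x. x \<in> E \<Longrightarrow> \<phi> 0 x \<in> E'"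
    and "\<And>x. x \<in> G \<Longrightarrow> \<phi> 0 x = 0"
    and "\<And>x. x \<in> ocompl E G \<Longrightarrow> norm (\<phi> 0 x) = norm x"
    and "\<And>f. f \<in> mcarrier (DA E) \<Longrightarrow> mult_op \<phi> f = (\<lambda>z. \<phi> 0 (f z))"
proof -
  let ?F = "ocompl E G" and ?c = "\<lambda>x. monomial_fun (\<lambda>_. 0) x :: complex ^ 'm \<Rightarrow> 'a"
  note F = hilbert_subspace_ocompl[OF E, of G]
  have FE: "?F \<subseteq> E"
    by (auto simp: ocompl_def)
  have zero: "0 \<in> E" "0 \<in> G" "0 \<in> ?F"
    using hilbert_subspaceD(1) E G F by auto
  have \<phi>: "\<phi> z \<in> Lspace E E'" if "z \<in> ball 0 1" for z
    using inner that by (simp add: inner_multiplier_def multiplier_def)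
  have cl: "bounded_clinear (blinfun_apply (\<phi> z))" if "z \<in> ball 0 1" for z
    using \<phi>[OF that] by (simp add: Lspace_def bounded_clinear_def blinfun.bounded_linear_right)
  show cl0: "bounded_clinear (blinfun_apply (\<phi> 0))"
    by (rule cl) simp
  show "\<phi> 0 x \<in> E'" if "x \<in> E" for x
    using \<phi>[of 0] that by (simp add: Lspace_def)
  have onG: "\<phi> z x = 0" if "x \<in> G" "z \<in> ball 0 1" for x z
  proof -
    have "?c x \<in> mkernel (DA E) (DA E') (mult_op \<phi>)"
      unfolding ker by (rule mem_DA_monomial_fun[OF zero(2) that(1)])
    then have "mult_op \<phi> (?c x) z = 0"
      by (simp add: mkernel_def)
    then show ?thesis
      using that(2) by (simp add: mult_op_def monomial_fun_def)
  qed
  show "\<phi> 0 x = 0" if "x \<in> G" for x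
    using onG[OF that, of 0] by simp
  have iso: "mnorm (DA E') (mult_op \<phi> g) = mnorm (DA E) g" if g: "g \<in> mcarrier (DA ?F)" for g
  proof -
    have "minner (DA E) g y = 0" if "y \<in> mkernel (DA E) (DA E') (mult_op \<phi>)" for y
      using that mem_DAD(2)[OF g] mem_DAD(2)[of y G] unfolding ker
      by (intro minner_DA_eq_0) (auto simp: ocompl_def)
    then show ?thesis
      using inner mem_DA_subset[OF g FE] by (auto simp: inner_multiplier_def partial_isometry_def)
  qed
  have onF: "norm (\<phi> 0 x) = norm x \<and> (\<forall>z\<in>ball 0 1. \<phi> z x = \<phi> 0 x)" if x: "x \<in> ?F" for x
  proof -
    let ?f = "mult_op \<phi> (?c x)"
    have cF: "?c x \<in> mcarrier (DA ?F)"
      by (rule mem_DA_monomial_fun[OF zero(3) x])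
    have fE: "?f \<in> mcarrier (DA E')"
      using inner mem_DA_subset[OF cF FE] by (simp add: inner_multiplier_def multiplier_def)
    define a where "a = da_coeff ?f"
    have a: "da_expansion a ?f"
      using mem_DAD(1)[OF fE] by (simp add: a_def)
    have act: "mult_op \<phi> (\<lambda>z. (z $ i) *\<^sub>C ?c x z) = (\<lambda>z. (z $ i) *\<^sub>C ?f z)" for i
      by (auto simp: mult_op_def monomial_fun_def bounded_clinearD(2)[OF cl] intro!: ext)
    have "mnorm (DA E') (\<lambda>z. (z $ i) *\<^sub>C ?f z) = mnorm (DA E') ?f" for i
      using iso[OF mem_DA_act[OF F cF, of i]] iso[OF cF] by (simp add: act mnorm_constant)
    then have "a k = 0" if "k \<noteq> (\<lambda>_. 0)" for k
      using constant_if_coordinates_preserve_norm[OF m a _ that] by blast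
    then have a_eq: "(\<lambda>l. if l = (\<lambda>_. 0) then a (\<lambda>_. 0) else 0) = a"
      by auto
    have "da_expansion a (monomial_fun (\<lambda>_. 0) (a (\<lambda>_. 0)))"
      using da_expansion_monomial_fun[of "\<lambda>_::'m. 0" "a (\<lambda>_. 0)"] unfolding a_eq .
    then have f_const: "?f = monomial_fun (\<lambda>_. 0) (a (\<lambda>_. 0))"
      by (rule da_expansion_fun_unique[OF a])
    have val: "\<phi> z x = a (\<lambda>_. 0)" if "z \<in> ball 0 1" for z
      using fun_cong[OF f_const, of z] that by (simp add: mult_op_def monomial_fun_def)
    have "norm (a (\<lambda>_. 0)) = norm x"
      using iso[OF cF] unfolding f_const by (simp add: mnorm_constant)
    then show ?thesis
      using val val[of 0] by simp
  qed
  then show "norm (\<phi> 0 x) = norm x" if "x \<in> ?F" for x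
    using that by blast
  show "mult_op \<phi> f = (\<lambda>z. \<phi> 0 (f z))" if f: "f \<in> mcarrier (DA E)" for f
  proof
    fix z
    show "mult_op \<phi> f z = \<phi> 0 (f z)"
    proof (cases "z \<in> ball 0 1")
      case z: True
      let ?p = "oproj G (f z)"
      have q: "f z - ?p \<in> ?F"
        by (rule diff_oproj_in_ocompl[OF G E GE mem_DA_value[OF E f]])
      have drop: "\<phi> w (f z - ?p) = \<phi> w (f z)" if "w \<in> ball 0 1" for w
        using onG[OF oproj_in[OF G] that] bounded_clinearD(5)[OF cl[OF that]] by simp
      have "\<phi> z (f z - ?p) = \<phi> 0 (f z - ?p)"
        using onF[OF q] z by blast
      then show ?thesis
        using drop[OF z] drop[of 0] by (simp add: mult_op_def)
    next
      case False
      then show ?thesis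
        using mem_DA_off_ball[OF f] by (simp add: mult_op_def)
    qed
  qed
qed


section \<open>The resolved module\<close>

text \<open>
  The adjoint of a co-isometry \<open>X\<close> with kernel \<open>H\<^sup>2 \<otimes> G\<close> inverts the restriction of \<open>X\<close> to
  \<open>H\<^sup>2 \<otimes> (E \<ominus> G)\<close>. It is a module map because the orthogonal complement of this particular kernel
  is itself a submodule.
\<close>

lemma coisometric_adjoint_unitary:
  fixes T :: "'m::finite \<Rightarrow> 'h::complex_hilbert \<Rightarrow> 'h"
    and X :: "(complex ^ 'm \<Rightarrow> 'e::complex_hilbert) \<Rightarrow> 'h"
  assumes E: "hilbert_subspace E" and G: "hilbert_subspace G" and GE: "G \<subseteq> E"
    and X: "module_map (DA E) (module_of T) X" "coisometric (DA E) (module_of T) X"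
    and ker: "mkernel (DA E) (module_of T) X = mcarrier (DA G)"
  shows "\<exists>V. unitary_module_map (module_of T) (DA (ocompl E G)) V \<and>
    (\<forall>f\<in>mcarrier (DA E). V (X f) = (\<lambda>z. oproj (ocompl E G) (f z)))"
proof -
  let ?F = "ocompl E G"
  let ?P = "\<lambda>f z. oproj ?F (f z)"
  note F = hilbert_subspace_ocompl[OF E, of G]
  have FE: "?F \<subseteq> E"
    by (auto simp: ocompl_def)
  have zero: "0 \<in> G" "0 \<in> E"
    using hilbert_subspaceD(1) G E by auto
  obtain V where V: "\<And>y. V y \<in> mcarrier (DA E)"
    and adj: "\<And>f y. f \<in> mcarrier (DA E) \<Longrightarrow> cinner (X f) y = minner (DA E) f (V y)"
    and XV: "\<And>y. X (V y) = y"
    using X(2) by (auto simp: coisometric_def module_of_def)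
  have Xadd: "X (\<lambda>z. f z + g z) = X f + X g"
    if "f \<in> mcarrier (DA E)" "g \<in> mcarrier (DA E)" for f g
    using X(1) that by (simp add: module_map_def module_of_def)
  have Xscale: "X (\<lambda>z. c *\<^sub>C f z) = c *\<^sub>C X f" if "f \<in> mcarrier (DA E)" for c f
    using X(1) that by (simp add: module_map_def module_of_def)
  have Xact: "X (\<lambda>z. (z $ i) *\<^sub>C f z) = T i (X f)" if "f \<in> mcarrier (DA E)" for f i
    using X(1) that by (simp add: module_map_def module_of_def)
  have Xdiff: "X (\<lambda>z. f z - g z) = X f - X g"
    if "f \<in> mcarrier (DA E)" "g \<in> mcarrier (DA E)" for f g
    using Xadd[OF mem_DA_diff[OF E that] that(2)] by simp
  have Xker: "X g = 0 \<longleftrightarrow> g \<in> mcarrier (DA G)" if "g \<in> mcarrier (DA E)" for g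
    using ker that by (auto simp: mkernel_def module_of_def)
  have VF: "V y \<in> mcarrier (DA ?F)" for y
  proof (rule mem_DAI[OF mem_DAD(1)[OF V]])
    fix k
    \<comment> \<open>The coefficients of \<open>V y\<close> are tested against the monomials in the kernel of \<open>X\<close>.\<close>
    have "cinner (da_coeff (V y) k) x = 0" if x: "x \<in> G" for x
    proof -
      let ?g = "monomial_fun k x"
      have g: "?g \<in> mcarrier (DA G)"
        by (rule mem_DA_monomial_fun[OF zero(1) x])
      have "0 = minner (DA E) ?g (V y)"
        using adj[OF mem_DA_subset[OF g GE], of y] Xker[OF mem_DA_subset[OF g GE]] g by simp
      also have "\<dots> = complex_of_real (da_weight k) * cinner x (da_coeff (V y) k)"
        unfolding minner_DA da_coeff_eq[OF da_expansion_monomial_fun]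
        by (intro infsumI has_sum_finite_neutralI[of "{k}"]) auto
      finally show ?thesis
        using da_weight_pos[of k] cinner_eq_0_commute by auto
    qed
    then show "da_coeff (V y) k \<in> ?F"
      using mem_DAD(2)[OF V] by (simp add: ocompl_def)
  qed
  have PF: "?P f \<in> mcarrier (DA ?F)" if "f \<in> mcarrier (DA E)" for f
    by (rule mem_DA_compose[OF bounded_clinear_oproj[OF F] that oproj_in[OF F]])
  have VX: "V (X f) = ?P f" if f: "f \<in> mcarrier (DA E)" for f
  proof -
    note PE = mem_DA_subset[OF PF[OF f] FE]
    let ?h = "\<lambda>z. V (X f) z - ?P f z"
    have "(\<lambda>z. oproj G (f z)) \<in> mcarrier (DA G)"
      by (rule mem_DA_compose[OF bounded_clinear_oproj[OF G] f oproj_in[OF G]])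
    moreover have "(\<lambda>z. oproj G (f z)) = (\<lambda>z. f z - ?P f z)"
      using oproj_ocompl[OF G E GE mem_DA_value[OF E f]] by simp
    ultimately have "X (\<lambda>z. f z - ?P f z) = 0"
      using Xker[OF mem_DA_diff[OF E f PE]] by simp
    then have "X ?h = 0"
      unfolding Xdiff[OF V PE] Xdiff[OF f PE] by (simp add: XV)
    then have hG: "?h \<in> mcarrier (DA G)"
      using Xker[OF mem_DA_diff[OF E V PE]] by simp
    have hF: "?h \<in> mcarrier (DA ?F)"
      by (rule mem_DA_diff[OF F VF PF[OF f]])
    \<comment> \<open>The difference takes its values in \<open>G\<close> and in the complement of \<open>G\<close>.\<close>
    have "?h z = 0" for z
      using mem_DA_value[OF G hG, of z] mem_DA_value[OF F hF, of z] by (rule ocompl_disjoint)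
    then show ?thesis
      by (auto simp: fun_eq_iff)
  qed
  have VXF: "V (X f) = f" if f: "f \<in> mcarrier (DA ?F)" for f
    using VX[OF mem_DA_subset[OF f FE]] oproj_ident[OF F mem_DA_value[OF F f]] by simp
  have inner: "minner (DA ?F) (V x) (V y) = cinner x y" for x y
    using adj[OF V, of x y] by (simp add: XV minner_DA)
  have "module_map (module_of T) (DA ?F) V"
    unfolding module_map_def
  proof (intro conjI)
    show "\<forall>x\<in>mcarrier (module_of T). V x \<in> mcarrier (DA ?F)"
      using VF by simp
    have "V (x + y) = (\<lambda>z. V x z + V y z)" for x y
      using VXF[OF mem_DA_add[OF F VF VF], of x y] Xadd[OF V V] by (simp add: XV)
    then show "\<forall>x\<in>mcarrier (module_of T). \<forall>y\<in>mcarrier (module_of T).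
        V (mplus (module_of T) x y) = mplus (DA ?F) (V x) (V y)"
      by (simp add: module_of_def)
    have "V (c *\<^sub>C x) = (\<lambda>z. c *\<^sub>C V x z)" for c x
      using VXF[OF mem_DA_scale[OF F VF], of c x] Xscale[OF V] by (simp add: XV)
    then show "\<forall>c. \<forall>x\<in>mcarrier (module_of T).
        V (mscale (module_of T) c x) = mscale (DA ?F) c (V x)"
      by (simp add: module_of_def)
    have "V (T i x) = (\<lambda>z. (z $ i) *\<^sub>C V x z)" for i x
      using VXF[OF mem_DA_act[OF F VF], of i x] Xact[OF V] by (simp add: XV)
    then show "\<forall>i. \<forall>x\<in>mcarrier (module_of T).
        V (mact (module_of T) i x) = mact (DA ?F) i (V x)"
      by (simp add: module_of_def)
    show "\<exists>C. \<forall>x\<in>mcarrier (module_of T). mnorm (DA ?F) (V x) \<le> C * mnorm (module_of T) x"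
      by (rule exI[of _ 1]) (simp add: mnorm_def inner module_of_def)
  qed
  moreover have "bij_betw V (mcarrier (module_of T)) (mcarrier (DA ?F))"
    by (rule bij_betw_byWitness[where f' = X]) (use VF VXF XV in \<open>auto simp: module_of_def\<close>)
  ultimately have "unitary_module_map (module_of T) (DA ?F) V"
    using inner by (simp add: unitary_module_map_def module_of_def)
  then show ?thesis
    using VX by blast
qed


section \<open>Split sequences of coefficient spaces\<close>

text \<open>
  What remains of an inner resolution when the connecting map \<open>X\<^sub>k\<^sub>+\<^sub>1\<close> is composition with
  \<open>B k\<close>: a sequence of partial isometries between the coefficient spaces, in which exactness makes
  the range of \<open>B (k + 1)\<close> the kernel of \<open>B k\<close>. At \<open>E 0\<close> there is no further map, and the complement
  \<open>F 0\<close> of the range is the coefficient space of the resolved module.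
\<close>

locale split_sequence =
  fixes E :: "nat \<Rightarrow> 'e::complex_hilbert set" and B :: "nat \<Rightarrow> 'e \<Rightarrow> 'e" and N :: nat
  assumes E: "hilbert_subspace (E k)"
    and E_zero: "k > N \<Longrightarrow> E k = {0}"
    and B: "bounded_clinear (B k)"
    and image: "hilbert_subspace (B k ` E (Suc k))" "B k ` E (Suc k) \<subseteq> E k"
    and B_B: "x \<in> E (Suc (Suc k)) \<Longrightarrow> B k (B (Suc k) x) = 0"
    and isometric: "x \<in> ocompl (E (Suc k)) (B (Suc k) ` E (Suc (Suc k))) \<Longrightarrow> norm (B k x) = norm x"
begin

definition G :: "nat \<Rightarrow> 'e set"
  where "G k = B k ` E (Suc k)"

definition F :: "nat \<Rightarrow> 'e set"
  where "F k = ocompl (E k) (G k)"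

lemma F: "hilbert_subspace (F k)" "F k \<subseteq> E k"
  unfolding F_def by (rule hilbert_subspace_ocompl[OF E]) (auto simp: ocompl_def)

lemma G: "hilbert_subspace (G k)" "G k \<subseteq> E k"
  using image by (auto simp: G_def)

lemma B_F: "x \<in> F (Suc k) \<Longrightarrow> norm (B k x) = norm x"
  using isometric by (simp add: F_def G_def)

lemma B_G: "x \<in> G (Suc k) \<Longrightarrow> B k x = 0"
  using B_B by (auto simp: G_def)

lemma G_eq: "G k = B k ` F (Suc k)"
  unfolding G_def[of k] F_def
  by (rule image_partial_isometry(1)[OF G(1) E G(2) B B_G B_F[unfolded F_def]])

lemma direct_sum_E: "direct_sum (F (Suc n)) (F n) (E n) (B n) (\<lambda>x. x)"
  unfolding direct_sum_def
proof (intro conjI)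
  note F' = hilbert_subspaceD[OF F(1)]
  show "\<forall>x\<in>F (Suc n). \<forall>y\<in>F (Suc n). cinner (B n x) (B n y) = cinner x y"
    using B_F F' B by (intro ballI cinner_isometric[of _ "F (Suc n)"]) (auto simp: bounded_clinear_def)
  have mem: "B n x \<in> G n" if "x \<in> F (Suc n)" for x
    using that by (simp add: G_eq)
  then show "\<forall>x\<in>F (Suc n). \<forall>y\<in>F n. cinner (B n x) y = 0"
    using cinner_eq_0_commute by (auto simp: F_def[of n] ocompl_def)
  show "E n = {B n x + y |x y. x \<in> F (Suc n) \<and> y \<in> F n}"
  proof
    show "E n \<subseteq> {B n x + y |x y. x \<in> F (Suc n) \<and> y \<in> F n}"
    proof
      fix v assume v: "v \<in> E n"
      obtain x where "x \<in> F (Suc n)" "oproj (G n) v = B n x"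
        using oproj_in[OF G(1), of n v] unfolding G_eq by auto
      moreover have "v - oproj (G n) v \<in> F n"
        unfolding F_def by (rule diff_oproj_in_ocompl[OF G(1) E G(2) v])
      moreover have "v = oproj (G n) v + (v - oproj (G n) v)"
        by simp
      ultimately show "v \<in> {B n x + y |x y. x \<in> F (Suc n) \<and> y \<in> F n}"
        by (smt (verit) mem_Collect_eq)
    qed
    show "{B n x + y |x y. x \<in> F (Suc n) \<and> y \<in> F n} \<subseteq> E n"
      using mem G(2) F(2) hilbert_subspaceD(2)[OF E] by blast
  qed
qed (use F E bounded_clinearD[OF B] in auto)

text \<open>The coefficient spaces after trivial extensions by \<open>F 1, \<dots>, F n\<close>.\<close>

definition coefs :: "nat \<Rightarrow> nat \<Rightarrow> 'e set"
  where "coefs n k = (if k < n then E k else if k = n then F n else {0})"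

text \<open>
  The maps are prescribed only on the function spaces on which they act, because the identity
  resolution and its trivial extensions may differ elsewhere from the given resolution.
\<close>

definition represents :: "nat \<Rightarrow> ('m::finite, 'e, complex ^ 'm \<Rightarrow> 'e) resolution \<Rightarrow> bool"
  where "represents n R \<longleftrightarrow> coef_space R = coefs n \<and> resolved R = DA (F 0) \<and>
    (\<forall>k. \<forall>f\<in>mcarrier (DA (coefs n (Suc k))). conn R (Suc k) f = (\<lambda>z. B k (f z))) \<and>
    (\<forall>f\<in>mcarrier (DA (coefs n 0)). aug R f = (\<lambda>z. oproj (F 0) (f z)))"

lemma conn_eq:
  assumes "represents n R" "k \<ge> 1" "f \<in> mcarrier (DA (coefs n k))"
  shows "conn R k f = (\<lambda>z. B (k - 1) (f z))"
  using assms by (cases k) (auto simp: represents_def)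

lemma represents_base: "represents 0 (identity_resolution (F 0))"
  unfolding represents_def
proof (intro conjI allI ballI)
  show "coef_space (identity_resolution (F 0)) = coefs 0"
    by (auto simp: identity_resolution_def coefs_def fun_eq_iff)
  show "resolved (identity_resolution (F 0)) = DA (F 0)"
    by (simp add: identity_resolution_def)
  show "conn (identity_resolution (F 0)) (Suc k) f = (\<lambda>z. B k (f z))"
    if "f \<in> mcarrier (DA (coefs 0 (Suc k)))" for k f
    using that bounded_clinearD(4)[OF B]
    by (simp add: identity_resolution_def coefs_def mem_DA_singleton_zero)
  show "aug (identity_resolution (F 0)) f = (\<lambda>z. oproj (F 0) (f z))"
    if "f \<in> mcarrier (DA (coefs 0 0))" for f
  proof
    have "f z \<in> F 0" for z
      using that mem_DA_value[OF F(1)] by (simp add: coefs_def)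
    from oproj_ident[OF F(1) this]
    show "aug (identity_resolution (F 0)) f z = oproj (F 0) (f z)" for z
      by (simp add: identity_resolution_def)
  qed
qed

text \<open>
  Passing from \<open>n\<close> to \<open>n + 1\<close> replaces \<open>F n\<close> by \<open>E n = B n (F (n + 1)) \<oplus> F n\<close> and appends
  \<open>F (n + 1)\<close>. This is a trivial extension unless \<open>F (n + 1)\<close> vanishes, and then nothing changes.
\<close>

lemma represents_step:
  fixes R :: "('m::finite, 'e, complex ^ 'm \<Rightarrow> 'e) resolution"
  assumes it: "iterated_trivial_extension R" and R: "represents n R"
  shows "\<exists>R' :: ('m, 'e, complex ^ 'm \<Rightarrow> 'e) resolution.
    iterated_trivial_extension R' \<and> represents (Suc n) R'"
proof (cases "F (Suc n) = {0}")
  case True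
  have "E n = F n"
    using direct_sum_E[of n] True bounded_clinearD(4)[OF B[of n]] by (auto simp: direct_sum_def)
  then have "coefs (Suc n) = coefs n"
    using True by (auto simp: coefs_def fun_eq_iff less_Suc_eq)
  then have "represents (Suc n) R"
    using R by (simp add: represents_def)
  with it show ?thesis
    by blast
next
  case False
  define R' where "R' = R\<lparr>coef_space := coefs (Suc n), conn := (\<lambda>k f z. B (k - 1) (f z)),
    aug := (\<lambda>f z. oproj (F 0) (f z))\<rparr>"
  have rep: "represents (Suc n) R'"
    using R by (simp add: represents_def R'_def)
  have "trivial_extension R (F (Suc n)) R'"
    unfolding trivial_extension_def
  proof (intro exI conjI)
    show "\<forall>k>n. coef_space R k = {0}"
      using R by (simp add: represents_def coefs_def)
    show "F (Suc n) \<noteq> {0}"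
      by (rule False)
    show "direct_sum (F (Suc n)) (coef_space R n) (E n) (B n) (\<lambda>x. x)"
      using direct_sum_E[of n] R by (simp add: represents_def coefs_def)
    show "coef_space R' = (coef_space R)(n := E n, Suc n := F (Suc n))"
      using R by (auto simp: R'_def represents_def coefs_def fun_eq_iff)
    show "resolved R' = resolved R"
      by (simp add: R'_def)
    show "\<forall>f\<in>mcarrier (DA (F (Suc n))). conn R' (Suc n) f = (\<lambda>z. B n (f z))"
      by (simp add: R'_def)
    show "\<forall>f\<in>mcarrier (DA (F (Suc n))). \<forall>g\<in>mcarrier (DA (coef_space R n)).
      if n = 0 then aug R' (\<lambda>z. B n (f z) + g z) = aug R g
      else conn R' n (\<lambda>z. B n (f z) + g z) = conn R n g"
    proof (intro ballI)
      fix f g :: "complex ^ 'm \<Rightarrow> 'e"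
      assume f: "f \<in> mcarrier (DA (F (Suc n)))" and g: "g \<in> mcarrier (DA (coef_space R n))"
      have fz: "f z \<in> F (Suc n)" for z
        by (rule mem_DA_value[OF F(1) f])
      have g': "g \<in> mcarrier (DA (coefs n n))"
        using g R by (simp add: represents_def)
      show "if n = 0 then aug R' (\<lambda>z. B n (f z) + g z) = aug R g
        else conn R' n (\<lambda>z. B n (f z) + g z) = conn R n g"
      proof (cases n)
        case 0
        have "oproj (F 0) (B 0 (f z)) = 0" for z
        proof -
          have y: "B 0 (f z) \<in> G 0"
            using fz[of z] 0 by (simp add: G_eq)
          then have "B 0 (f z) \<in> E 0"
            using G(2) by blast
          from oproj_ocompl[OF G(1) E G(2) this] show ?thesis
            by (simp add: F_def oproj_ident[OF G(1) y])
        qed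
        then show ?thesis
          using 0 R g' by (simp add: R'_def represents_def bounded_clinearD(1)[OF bounded_clinear_oproj[OF F(1)]])
      next
        case (Suc m)
        have "B m (B n (f z)) = 0" for z
          using B_B[of "f z" m] fz[of z] F(2)[of "Suc n"] Suc by auto
        then show ?thesis
          using Suc conn_eq[OF R _ g'] by (simp add: R'_def bounded_clinearD(1)[OF B])
      qed
    qed
    show "\<forall>k\<ge>1. k \<noteq> n \<longrightarrow> k \<noteq> Suc n \<longrightarrow>
      (\<forall>f\<in>mcarrier (DA (coef_space R k)). conn R' k f = conn R k f)"
      using conn_eq[OF R] R by (simp add: R'_def represents_def)
    show "n \<noteq> 0 \<longrightarrow> (\<forall>f\<in>mcarrier (DA (coef_space R 0)). aug R' f = aug R f)"
      using R by (simp add: R'_def represents_def)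
  qed
  then show ?thesis
    using it rep iterated_trivial_extension.step by blast
qed

lemma coefs_N: "coefs N = E"
proof
  fix k
  have "G N = {0}"
    using E_zero[of "Suc N"] bounded_clinearD(4)[OF B] by (simp add: G_def)
  then have "F N = E N"
    by (auto simp: F_def ocompl_def)
  then show "coefs N k = E k"
    using E_zero[of k] by (auto simp: coefs_def)
qed

lemma exists_iterated_trivial_extension:
  "\<exists>R :: ('m::finite, 'e, complex ^ 'm \<Rightarrow> 'e) resolution.
    iterated_trivial_extension R \<and> represents N R"
proof -
  have "\<exists>R :: ('m, 'e, complex ^ 'm \<Rightarrow> 'e) resolution.
    iterated_trivial_extension R \<and> represents n R" for n
  proof (induction n)
    case 0
    show ?case
      using iterated_trivial_extension.base[OF F(1)] represents_base by blast
  next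
    case (Suc n)
    then show ?case
      using represents_step by blast
  qed
  then show ?thesis .
qed

end


section \<open>Kernels in an inner resolution\<close>

text \<open>
  If the kernel at one place consists of the functions with values in a closed subspace, then so
  does the range. By exactness the range is the next kernel, which makes a descending induction
  along the resolution possible.
\<close>

lemma inner_multiplier_range:
  fixes \<phi> :: "complex ^ 'm::finite \<Rightarrow> 'a::complex_hilbert \<Rightarrow>\<^sub>L 'b::complex_hilbert"
  assumes m: "CARD('m) > 1"
    and E: "hilbert_subspace E" and inner: "inner_multiplier E E' \<phi>"
    and G: "hilbert_subspace G" and GE: "G \<subseteq> E"
    and ker: "mkernel (DA E) (DA E') (mult_op \<phi>) = mcarrier (DA G)"
  shows "hilbert_subspace (\<phi> 0 ` E)" and "\<phi> 0 ` E \<subseteq> E'"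
    and "mult_op \<phi> ` mcarrier (DA E) = mcarrier (DA (\<phi> 0 ` E))"
proof -
  note c = inner_multiplier_constant[OF assms]
  show "hilbert_subspace (\<phi> 0 ` E)"
    by (rule image_partial_isometry(2)[OF G E GE c(1,3,4)])
  show "\<phi> 0 ` E \<subseteq> E'"
    using c(2) by auto
  have "mult_op \<phi> ` mcarrier (DA E) = (\<lambda>f z. \<phi> 0 (f z)) ` mcarrier (DA E)"
    using c(5) by (rule image_cong[OF refl])
  then show "mult_op \<phi> ` mcarrier (DA E) = mcarrier (DA (\<phi> 0 ` E))"
    using image_DA_partial_isometry[OF G E GE c(1,3,4)] by simp
qed

lemma mkernel_cong:
  "(\<And>f. f \<in> mcarrier H \<Longrightarrow> X f = Y f) \<Longrightarrow> mkernel H H' X = mkernel H H' Y"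
  by (auto simp: mkernel_def)

lemma finite_inner_resolutionD:
  assumes "finite_inner_resolution N R"
  shows "\<forall>k. hilbert_subspace (coef_space R k)"
    and "\<forall>k>N. coef_space R k = {0}"
    and "\<forall>k\<ge>1. \<exists>\<phi>. inner_multiplier (coef_space R k) (coef_space R (k - 1)) \<phi> \<and>
      (\<forall>f\<in>mcarrier (DA (coef_space R k)). conn R k f = mult_op \<phi> f)"
    and "module_map (DA (coef_space R 0)) (resolved R) (aug R)"
    and "coisometric (DA (coef_space R 0)) (resolved R) (aug R)"
    and "conn R 1 ` mcarrier (DA (coef_space R 1)) =
      mkernel (DA (coef_space R 0)) (resolved R) (aug R)"
    and "\<forall>k\<ge>1. conn R (Suc k) ` mcarrier (DA (coef_space R (Suc k))) =
      mkernel (DA (coef_space R k)) (DA (coef_space R (k - 1))) (conn R k)"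
proof -
  note d = assms[unfolded finite_inner_resolution_def exact_resolution_def Let_def]
  note d3 = d[THEN conjunct2, THEN conjunct2]
  note d5 = d3[THEN conjunct2, THEN conjunct2]
  note d7 = d5[THEN conjunct2, THEN conjunct2]
  show "\<forall>k. hilbert_subspace (coef_space R k)"
    by (rule d[THEN conjunct1])
  show "\<forall>k>N. coef_space R k = {0}"
    by (rule d[THEN conjunct2, THEN conjunct1])
  show "\<forall>k\<ge>1. \<exists>\<phi>. inner_multiplier (coef_space R k) (coef_space R (k - 1)) \<phi> \<and>
      (\<forall>f\<in>mcarrier (DA (coef_space R k)). conn R k f = mult_op \<phi> f)"
    by (rule d3[THEN conjunct1])
  show "module_map (DA (coef_space R 0)) (resolved R) (aug R)"
    by (rule d3[THEN conjunct2, THEN conjunct1])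
  show "coisometric (DA (coef_space R 0)) (resolved R) (aug R)"
    by (rule d5[THEN conjunct1])
  show "conn R 1 ` mcarrier (DA (coef_space R 1)) =
      mkernel (DA (coef_space R 0)) (resolved R) (aug R)"
    by (rule d7[THEN conjunct1])
  show "\<forall>k\<ge>1. conn R (Suc k) ` mcarrier (DA (coef_space R (Suc k))) =
      mkernel (DA (coef_space R k)) (DA (coef_space R (k - 1))) (conn R k)"
    by (rule d7[THEN conjunct2])
qed

theorem corollary4p5:
  fixes T :: "'m::finite \<Rightarrow> 'h::complex_hilbert \<Rightarrow> 'h"
    and R :: "('m, 'e::complex_hilbert, 'h) resolution"
    and N :: nat
  assumes "CARD('m) > 1"
    and "hilbert_module T"
    and "cospherically_contractive T"
    and "pure_module T"
    and "resolved R = module_of T"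
    and "finite_inner_resolution N R"
  shows "trivial_inner_resolution R"
proof -
  define E where "E = coef_space R"
  define H :: "nat \<Rightarrow> (complex ^ 'm \<Rightarrow> 'e, 'm) hmod" where "H k = DA (E k)" for k
  note fin = finite_inner_resolutionD[OF assms(6), folded E_def, unfolded assms(5)]
  have E: "hilbert_subspace (E k)" and E_zero: "k > N \<Longrightarrow> E k = {0}" for k
    using fin(1,2) by blast+
  note conn_ex = fin(3) and aug = fin(4,5) and conn_exact0 = fin(6) and conn_exact = fin(7)
  have "\<exists>\<phi>. inner_multiplier (E (Suc k)) (E k) \<phi> \<and>
      (\<forall>f\<in>mcarrier (H (Suc k)). conn R (Suc k) f = mult_op \<phi> f)" for k
    using conn_ex[rule_format, of "Suc k"] by (simp add: H_def)
  then obtain \<phi> where \<phi>: "\<And>k. inner_multiplier (E (Suc k)) (E k) (\<phi> k)"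
    and conn: "\<And>k f. f \<in> mcarrier (H (Suc k)) \<Longrightarrow> conn R (Suc k) f = mult_op (\<phi> k) f"
    by metis
  define B where "B k = blinfun_apply (\<phi> k 0)" for k
  define K where "K k = B k ` E (Suc k)" for k
  have image_conn: "conn R (Suc k) ` mcarrier (H (Suc k)) = mult_op (\<phi> k) ` mcarrier (H (Suc k))" for k
    using conn by (rule image_cong[OF refl])
  have exact: "mult_op (\<phi> (Suc k)) ` mcarrier (H (Suc (Suc k))) =
      mkernel (H (Suc k)) (H k) (mult_op (\<phi> k))" for k
  proof -
    have "mkernel (H (Suc k)) (H k) (conn R (Suc k)) = mkernel (H (Suc k)) (H k) (mult_op (\<phi> k))"
      using conn by (rule mkernel_cong)
    then show ?thesis
      using conn_exact[rule_format, of "Suc k"] image_conn[of "Suc k"] by (simp add: H_def)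
  qed
  have exact0: "mult_op (\<phi> 0) ` mcarrier (H 1) = mkernel (H 0) (module_of T) (aug R)"
    using conn_exact0 image_conn[of 0] by (simp add: H_def)
  have kerG_large: "\<exists>G'. hilbert_subspace G' \<and> G' \<subseteq> E (Suc k) \<and>
      mkernel (H (Suc k)) (H k) (mult_op (\<phi> k)) = mcarrier (DA G')" if "N \<le> k" for k
  proof (intro exI conjI)
    have E0: "E (Suc k) = {0}"
      by (rule E_zero) (use that in simp)
    then show "{0} \<subseteq> E (Suc k)"
      by simp
    show "mkernel (H (Suc k)) (H k) (mult_op (\<phi> k)) = mcarrier (DA {0})"
      unfolding mkernel_def H_def E0
      by (simp add: set_eq_iff mem_DA_singleton_zero mult_op_def cong: conj_cong)
    show "hilbert_subspace ({0} :: 'e set)"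
      by (rule hilbert_subspace_zero)
  qed
  \<comment> \<open>Descending induction, which starts where the coefficient spaces vanish.\<close>
  have kerG: "\<exists>G'. hilbert_subspace G' \<and> G' \<subseteq> E (Suc k) \<and>
      mkernel (H (Suc k)) (H k) (mult_op (\<phi> k)) = mcarrier (DA G')" for k
  proof (cases "N \<le> k")
    case False
    then have "k \<le> N"
      by simp
    then show ?thesis
    proof (induction k rule: inc_induct)
      case base
      show ?case
        by (rule kerG_large) simp
    next
      case (step k)
      from step.IH obtain G' where G': "hilbert_subspace G'" "G' \<subseteq> E (Suc (Suc k))"
        "mkernel (H (Suc (Suc k))) (H (Suc k)) (mult_op (\<phi> (Suc k))) = mcarrier (DA G')"
        by blast
      note range = inner_multiplier_range[OF assms(1) E \<phi> G'[unfolded H_def], folded H_def]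
      show ?case
        using range(1,2) exact[of k, unfolded range(3), symmetric] by (intro exI conjI)
    qed
  qed (rule kerG_large)
  have range: "hilbert_subspace (K k)" "K k \<subseteq> E k"
    "mult_op (\<phi> k) ` mcarrier (H (Suc k)) = mcarrier (DA (K k))" for k
  proof -
    from kerG[of k] obtain G' where G': "hilbert_subspace G'" "G' \<subseteq> E (Suc k)"
      "mkernel (H (Suc k)) (H k) (mult_op (\<phi> k)) = mcarrier (DA G')"
      by blast
    from inner_multiplier_range[OF assms(1) E \<phi> G'[unfolded H_def], folded H_def B_def K_def]
    show "hilbert_subspace (K k)" "K k \<subseteq> E k"
      "mult_op (\<phi> k) ` mcarrier (H (Suc k)) = mcarrier (DA (K k))" .
  qed
  have ker: "mkernel (H (Suc k)) (H k) (mult_op (\<phi> k)) = mcarrier (DA (K (Suc k)))" for k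
    using exact[of k] range(3)[of "Suc k"] by simp
  note const = inner_multiplier_constant[OF assms(1) E \<phi> range(1,2) ker[unfolded H_def], folded B_def]
  interpret split_sequence E B N
  proof
    show "hilbert_subspace (B k ` E (Suc k))" "B k ` E (Suc k) \<subseteq> E k" for k
      using range(1,2)[of k] by (simp_all add: K_def)
    show "B k (B (Suc k) x) = 0" if "x \<in> E (Suc (Suc k))" for k x
      using const(3)[of "B (Suc k) x" k] that by (simp add: K_def)
    show "norm (B k x) = norm x" if "x \<in> ocompl (E (Suc k)) (B (Suc k) ` E (Suc (Suc k)))" for k x
      using const(4)[of x k] that by (simp add: K_def)
  qed (use E E_zero const(1) in auto)
  have ker0: "mkernel (DA (E 0)) (module_of T) (aug R) = mcarrier (DA (K 0))"
    using exact0 range(3)[of 0] by (simp add: H_def)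
  have F0: "F 0 = ocompl (E 0) (K 0)"
    by (simp add: F_def G_def K_def)
  obtain V where V: "unitary_module_map (module_of T) (DA (F 0)) V"
    and V_aug: "\<And>f. f \<in> mcarrier (DA (E 0)) \<Longrightarrow> V (aug R f) = (\<lambda>z. oproj (F 0) (f z))"
    using coisometric_adjoint_unitary[OF E range(1,2) aug ker0] unfolding F0 by blast
  obtain R' :: "('m, 'e, complex ^ 'm \<Rightarrow> 'e) resolution"
    where it: "iterated_trivial_extension R'" and rep: "represents N R'"
    using exists_iterated_trivial_extension by blast
  have R': "coef_space R' = E" "resolved R' = DA (F 0)"
    "\<And>f. f \<in> mcarrier (DA (E 0)) \<Longrightarrow> aug R' f = (\<lambda>z. oproj (F 0) (f z))"
    using rep by (auto simp: represents_def coefs_N)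
  have conn_R': "conn R k f = conn R' k f" if k: "k \<ge> 1" "f \<in> mcarrier (DA (E k))" for k f
  proof -
    obtain l where l: "k = Suc l"
      using k(1) by (cases k) auto
    have "conn R' k f = (\<lambda>z. B l (f z))"
      using conn_eq[OF rep k(1)] k(2) l by (simp add: coefs_N)
    moreover have "conn R k f = (\<lambda>z. B l (f z))"
      using conn[of f l] const(5)[of f l] k(2) l by (simp add: H_def)
    ultimately show ?thesis
      by simp
  qed
  have id: "unitary_module_map (DA (E k)) (DA (E k)) (\<lambda>f :: complex ^ 'm \<Rightarrow> 'e. f)" for k
    unfolding unitary_module_map_def module_map_def
    by (auto intro: exI[of _ 1] simp: bij_betw_def)
  \<comment> \<open>Both sequences have the same coefficient spaces, so only the resolved modules are moved.\<close>
  have "equivalent_resolutions R R'"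
    unfolding equivalent_resolutions_def Let_def assms(5) R'(1,2) E_def[symmetric]
  proof (intro exI conjI)
    show "\<forall>k. unitary_module_map (DA (E k)) (DA (E k)) (\<lambda>f :: complex ^ 'm \<Rightarrow> 'e. f)"
      using id by blast
    show "unitary_module_map (module_of T) (DA (F 0)) V"
      by (rule V)
    show "\<forall>k\<ge>1. \<forall>f\<in>mcarrier (DA (E k)). conn R k f = conn R' k f"
      using conn_R' by blast
    show "\<forall>f\<in>mcarrier (DA (E 0)). V (aug R f) = aug R' f"
      using V_aug R'(3) by simp
  qed
  with it show ?thesis
    unfolding trivial_inner_resolution_def by blast
qed

end
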